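(* Let $a_1,a_2,a_3,a_4,b_1,b_2,b_3,b_4\in\mathbb{R}$ and consider the ODE on $\mathbb{R}^2$ $$\dot u = e^{a_1 u+b_1 v}-e^{a_2 u+b_2 v},\qquad \dot v = e^{a_3 u+b_3 v}-e^{a_4 u+b_4 v},$$ whose Jacobian matrix at the origin is $J=\begin{pmatrix} a_1-a_2 & b_1-b_2\\ a_3-a_4 & b_3-b_4\end{pmatrix}$. Assume that $J_{11}J_{22}\ge 0$ (i.e., $(a_1-a_2)(b_3-b_4)\ge 0$). Then the following three statements are equivalent. (i) The ODE is permanent. (ii) The origin is globally asymptotically stable for the ODE. (iii) $\det J>0$ and one of (A), (B1), (B2) below holds. (A) $\operatorname{sgn} J=\begin{pmatrix} - & *\\ * & -\end{pmatrix}$; (B1) $\operatorname{sgn} J=\begin{pmatrix} 0 & *\\ * & -\end{pmatrix}$ and $\min(a_3,a_4)\le a_2=a_1\le\max(a_3,a_4)$; (B2) $\operatorname{sgn} J=\begin{pmatrix} - & *\\ * & 0\end{pmatrix}$ and $\min(b_1,b_2)\le b_4=b_3\le\max(b_1,b_2)$.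
   Context: The ODE is called permanent if there exists a compact subset of $\mathbb{R}^2$ that is forward invariant and is a global attractor (it attracts every point of $\mathbb{R}^2$). The sign $\operatorname{sgn}$ of a matrix is taken entrywise; $*$ stands for an arbitrary sign (no condition on that entry). *)

theory Defs
  imports "HOL-Analysis.Analysis"
begin

text \<open>The vector fields below need not be forward complete (solutions may blow up in finite
  time), so the dynamical notions are phrased through solutions on intervals rather than
  through a globally defined flow.\<close>

definition ode_solution ::
    "('a::real_normed_vector \<Rightarrow> 'a) \<Rightarrow> (real \<Rightarrow> 'a) \<Rightarrow> real set \<Rightarrow> bool"
  where "ode_solution F x I \<longleftrightarrow>
    (\<forall>t\<in>I. (x has_vector_derivative F (x t)) (at t within I))"

definition forward_invariant :: "('a::real_normed_vector \<Rightarrow> 'a) \<Rightarrow> 'a set \<Rightarrow> bool"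
  where "forward_invariant F K \<longleftrightarrow>
    (\<forall>T\<ge>0. \<forall>x. ode_solution F x {0..T} \<and> x 0 \<in> K \<longrightarrow> (\<forall>t\<in>{0..T}. x t \<in> K))"

text \<open>Being attracted includes existence of the solution for all forward time.\<close>

definition attracts_point :: "('a::real_normed_vector \<Rightarrow> 'a) \<Rightarrow> 'a set \<Rightarrow> 'a \<Rightarrow> bool"
  where "attracts_point F K p \<longleftrightarrow>
    (\<exists>x. ode_solution F x {0..} \<and> x 0 = p) \<and>
    (\<forall>x. ode_solution F x {0..} \<and> x 0 = p \<longrightarrow> ((\<lambda>t. infdist (x t) K) \<longlongrightarrow> 0) at_top)"

text \<open>The condition \<open>K \<noteq> {}\<close> is needed because \<open>infdist y {} = 0\<close> by convention.\<close>

definition global_attractor :: "('a::real_normed_vector \<Rightarrow> 'a) \<Rightarrow> 'a set \<Rightarrow> bool"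
  where "global_attractor F K \<longleftrightarrow> K \<noteq> {} \<and> (\<forall>p. attracts_point F K p)"

definition permanent :: "('a::real_normed_vector \<Rightarrow> 'a) \<Rightarrow> bool"
  where "permanent F \<longleftrightarrow>
    (\<exists>K. compact K \<and> forward_invariant F K \<and> global_attractor F K)"

definition lyapunov_stable :: "('a::real_normed_vector \<Rightarrow> 'a) \<Rightarrow> 'a \<Rightarrow> bool"
  where "lyapunov_stable F p \<longleftrightarrow>
    (\<forall>\<epsilon>>0. \<exists>\<delta>>0. \<forall>T\<ge>0. \<forall>x. ode_solution F x {0..T} \<and> dist (x 0) p < \<delta>
       \<longrightarrow> (\<forall>t\<in>{0..T}. dist (x t) p < \<epsilon>))"

definition globally_asymptotically_stable :: "('a::real_normed_vector \<Rightarrow> 'a) \<Rightarrow> 'a \<Rightarrow> bool"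
  where "globally_asymptotically_stable F p \<longleftrightarrow>
    F p = 0 \<and> lyapunov_stable F p \<and> global_attractor F {p}"

definition exp_field ::
    "real \<Rightarrow> real \<Rightarrow> real \<Rightarrow> real \<Rightarrow> real \<Rightarrow> real \<Rightarrow> real \<Rightarrow> real \<Rightarrow> real^2 \<Rightarrow> real^2"
  where "exp_field a1 a2 a3 a4 b1 b2 b3 b4 w =
    (let u = w $ 1; v = w $ 2 in
     vector [exp (a1 * u + b1 * v) - exp (a2 * u + b2 * v),
             exp (a3 * u + b3 * v) - exp (a4 * u + b4 * v)])"

definition jacobian_at_origin ::
    "real \<Rightarrow> real \<Rightarrow> real \<Rightarrow> real \<Rightarrow> real \<Rightarrow> real \<Rightarrow> real \<Rightarrow> real \<Rightarrow> real^2^2"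
  where "jacobian_at_origin a1 a2 a3 a4 b1 b2 b3 b4 =
    vector [vector [a1 - a2, b1 - b2],
            vector [a3 - a4, b3 - b4]]"

lemma exp_field_has_derivative_at_origin:
  "(exp_field a1 a2 a3 a4 b1 b2 b3 b4 has_derivative
     (*v) (jacobian_at_origin a1 a2 a3 a4 b1 b2 b3 b4)) (at 0)"
proof -
  let ?J = "jacobian_at_origin a1 a2 a3 a4 b1 b2 b3 b4"
  have *: "((\<lambda>w::real^2. exp (p * w$1 + q * w$2) - exp (r * w$1 + s * w$2)) has_derivative
     (\<lambda>h. (p - r) * h$1 + (q - s) * h$2)) (at 0)" for p q r s :: real
  proof -
    have c: "((\<lambda>w::real^2. w $ i) has_derivative (\<lambda>h. h $ i)) (at 0)" for i
      by (rule bounded_linear.has_derivative[OF bounded_linear_vec_nth has_derivative_ident])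
    have e: "((\<lambda>w::real^2. exp (p * w$1 + q * w$2)) has_derivative
       (\<lambda>h. p * h$1 + q * h$2)) (at 0)" for p q
      using has_derivative_exp[OF has_derivative_add[OF
          has_derivative_mult_right[OF c[of 1], of p] has_derivative_mult_right[OF c[of 2], of q]]]
      by simp
    show ?thesis
      using has_derivative_diff[OF e[of p q] e[of r s]] by (simp add: algebra_simps)
  qed
  have "((\<lambda>w. exp_field a1 a2 a3 a4 b1 b2 b3 b4 w $ i) has_derivative (\<lambda>h. (?J *v h) $ i)) (at 0)"
    for i
    using *[of a1 b1 a2 b2] *[of a3 b3 a4 b4] exhaust_2[of i]
    by (auto simp: exp_field_def jacobian_at_origin_def Let_def matrix_vector_mult_def sum_2)
  then have "\<forall>b\<in>Basis. ((\<lambda>w. exp_field a1 a2 a3 a4 b1 b2 b3 b4 w \<bullet> b) has_derivative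
      (\<lambda>h. (?J *v h) \<bullet> b)) (at 0)"
    by (auto simp: Basis_vec_def inner_axis)
  then show ?thesis
    by (subst has_derivative_componentwise_within) simp
qed

end

theory Submission
  imports Defs
begin

text \<open>Write \<open>p = a1 - a2\<close>, \<open>q = b1 - b2\<close>, \<open>r = a3 - a4\<close>, \<open>s = b3 - b4\<close> for the entries of the
  Jacobian. The two components of the field have the signs of \<open>p u + q v\<close> and \<open>r u + s v\<close>, so
  the linear part already decides where each coordinate grows and where it decays.

  Sufficiency. If \<open>p, s < 0\<close> and \<open>\<bar>q r\<bar> < p s\<close>, a suitable weighted maximum norm decreases: at a
  point where one coordinate attains the maximum, its diagonal term beats the off-diagonal one
  (\<open>globally_asymptotically_stable_diagonal_dominant\<close>). All other cases of the criterion have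
  \<open>q r < 0\<close>, so that solutions may spiral. By reflecting a coordinate we may take \<open>q < 0 < r\<close>,
  and by exchanging the coordinates \<open>s < 0\<close>.
  Put \<open>A_i = exp ((a_i - a1) u)\<close> and \<open>B_i = exp ((b_i - b3) v)\<close>. Up to the positive factor
  \<open>exp (a1 u + b3 v)\<close> the field is \<open>(B1 - A2 B2, A3 - A4 B4)\<close>. For \<open>p = s = 0\<close> it is Hamiltonian
  with the separable function \<open>V\<close> whose partial derivatives are \<open>A3 - A4\<close> and \<open>B2 - B1\<close>. In
  general the cross terms still cancel and, up to that factor,
  \<open>V' = (A3 - A4) (1 - A2) B2 + (B2 - B1) (1 - B4) A4\<close>,
  which has a definite sign as soon as \<open>p\<close> and \<open>s\<close> do not have opposite signs
  (\<open>lyap_rate_eq\<close>). For \<open>p, s \<le> 0\<close> this makes \<open>V\<close> a Lyapunov function. It need not be proper,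
  but since \<open>a4 < a3\<close> it always grows at least linearly in one of the directions \<open>u \<rightarrow> \<plusminus>\<infinity>\<close>. If
  \<open>p, s < 0\<close>, a bound on \<open>u\<close> on one side travels once around the spiral through the nullclines and
  bounds both coordinates on both sides. If \<open>p = 0\<close>, no such turn is available for \<open>u\<close>; the
  condition \<open>a4 \<le> a1 \<le> a3\<close> says precisely that \<open>V\<close> bounds \<open>u\<close> on both sides. Convergence to the
  origin follows by applying Barbalat's lemma to \<open>V\<close> and then to \<open>v\<close>
  (\<open>globally_asymptotically_stable_spiral\<close>).

  Necessity. Permanence bounds every level that a continuous function keeps along a solution
  (\<open>permanent_bounds_persistent_levels\<close>). Hence it excludes a line of equilibria (\<open>det J = 0\<close>);
  it excludes an invariant quadrant arbitrarily far out, which exists if \<open>det J < 0\<close>, or if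
  \<open>p, s > 0\<close> and \<open>q r \<ge> 0\<close>; it excludes \<open>p, s \<ge> 0\<close> with \<open>q r < 0\<close>, where \<open>V\<close> is unbounded and
  nondecreasing; and it excludes \<open>p = 0 > s\<close> with \<open>a1\<close> outside the interval between \<open>a3\<close> and
  \<open>a4\<close>, because then, far out on one side, \<open>u\<close> moves outward so much faster than \<open>v\<close> that the
  solution never turns round.

  Solutions of the field need not exist for all forward time, but a solution that cannot leave a
  bounded set does. This is proved by Picard iteration for a truncated field
  (\<open>global_solution_if_reachable_bounded\<close>).\<close>

section \<open>Solutions and barriers\<close>

lemma ode_solution_subset:
  "ode_solution F x J \<Longrightarrow> I \<subseteq> J \<Longrightarrow> ode_solution F x I"
  unfolding ode_solution_def by (meson has_vector_derivative_within_subset subsetD)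

lemma ode_solution_nth_derivative:
  fixes F :: "real^2 \<Rightarrow> real^2"
  assumes "ode_solution F x I" "t \<in> I"
  shows "((\<lambda>t. x t $ i) has_real_derivative F (x t) $ i) (at t within I)"
proof -
  have "(x has_vector_derivative F (x t)) (at t within I)"
    using assms by (auto simp: ode_solution_def)
  from bounded_linear.has_vector_derivative[OF bounded_linear_vec_nth this]
  show ?thesis by (simp add: has_real_derivative_iff_has_vector_derivative)
qed

lemma ode_solution_continuous_on: "ode_solution F x I \<Longrightarrow> continuous_on I x"
  unfolding ode_solution_def continuous_on_eq_continuous_within
  by (blast intro: has_vector_derivative_continuous)

lemma ode_solution_shift:
  assumes "ode_solution F x {0..}" "0 \<le> s"
  shows "ode_solution F (\<lambda>t. x (t + s)) {0..}"
  unfolding ode_solution_def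
proof
  fix t :: real assume t: "t \<in> {0..}"
  have "(x has_vector_derivative F (x (t + s))) (at (t + s) within {0..})"
    using assms t by (simp add: ode_solution_def)
  then have "(x has_vector_derivative F (x (t + s))) (at (t + s) within (\<lambda>t. t + s) ` {0..})"
    by (rule has_vector_derivative_within_subset) (use assms(2) in auto)
  moreover have "((\<lambda>t. t + s) has_vector_derivative 1) (at t within {0..})"
    by (auto intro!: derivative_eq_intros)
  ultimately show "((\<lambda>t. x (t + s)) has_vector_derivative F (x (t + s))) (at t within {0..})"
    using vector_diff_chain_within[of "\<lambda>t. t + s" 1 t "{0..}" x "F (x (t + s))"] by (simp add: o_def)
qed

text \<open>A maximum principle. A solution that stays in a box or a strip is handled by describing the
region as \<open>f i \<le> c\<close> for finitely many \<open>i\<close>: at the first time when the maximum of the \<open>f i\<close> reaches a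
level \<open>e > c\<close>, a maximal component has a nonnegative left derivative. Only levels \<open>e\<close> close to \<open>c\<close>
occur, so inwardness is required only below an arbitrary \<open>d > c\<close>; it has to hold strictly
above \<open>c\<close>, in exchange for nothing being asked on the boundary itself.\<close>

lemma barrier_family:
  fixes f f' :: "'i \<Rightarrow> real \<Rightarrow> real"
  assumes fin: "finite I" and cd: "c < d"
    and der: "\<And>i t. i \<in> I \<Longrightarrow> t \<in> {0..T} \<Longrightarrow>
                (f i has_real_derivative f' i t) (at t within {0..T})"
    and init: "\<And>i. i \<in> I \<Longrightarrow> f i 0 \<le> c"
    and inward: "\<And>i t. i \<in> I \<Longrightarrow> t \<in> {0..T} \<Longrightarrow> c < f i t \<Longrightarrow> f i t < d \<Longrightarrow>
                (\<And>j. j \<in> I \<Longrightarrow> f j t \<le> f i t) \<Longrightarrow> f' i t < 0"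
    and i: "i \<in> I" and t: "t \<in> {0..T}"
  shows "f i t \<le> c"
proof (rule ccontr)
  assume "\<not> f i t \<le> c"
  then have gt: "f i t > c" by simp
  have cont: "continuous_on {0..T} (f j)" if "j \<in> I" for j
    using der[OF that] by (rule DERIV_continuous_on)
  define e where "e = min (f i t) ((c + d) / 2)"
  have e: "c < e" "e < d" "e \<le> f i t" using gt cd by (auto simp: e_def min_def)
  define S where "S = (\<Union>j\<in>I. {s \<in> {0..T}. e \<le> f j s})"
  have "compact S"
    unfolding S_def
  proof (intro compact_UN fin)
    fix j assume "j \<in> I"
    have "closed {s \<in> {0..T}. e \<le> f j s}"
      by (rule continuous_on_closed_Collect_le) (auto intro: cont[OF \<open>j \<in> I\<close>])
    then show "compact {s \<in> {0..T}. e \<le> f j s}"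
      by (auto simp: compact_eq_bounded_closed intro: bounded_subset[OF bounded_closed_interval])
  qed
  moreover have "S \<noteq> {}" using e i t by (auto simp: S_def)
  \<comment> \<open>The first time at which some component reaches the level \<open>e\<close>.\<close>
  ultimately obtain \<tau> where \<tau>: "\<tau> \<in> S" "\<And>s. s \<in> S \<Longrightarrow> \<tau> \<le> s"
    using compact_attains_inf[of S] by blast
  then obtain k where k: "k \<in> I" "e \<le> f k \<tau>" and \<tau>T: "\<tau> \<in> {0..T}" by (auto simp: S_def)
  have pos: "\<tau> > 0" using init[OF k(1)] k e \<tau>T by (cases "\<tau> = 0") auto
  have before: "f j s < e" if "j \<in> I" "0 \<le> s" "s < \<tau>" for j s
    using \<tau>(2)[of s] that \<tau>T by (force simp: S_def)
  have le: "f j \<tau> \<le> e" if "j \<in> I" for j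
  proof (rule ccontr)
    assume "\<not> f j \<tau> \<le> e"
    then have "\<exists>s\<ge>0. s \<le> \<tau> \<and> f j s = e"
      using init[OF that] e \<tau>T
      by (intro IVT' continuous_on_subset[OF cont[OF that]]) auto
    with before[OF that] \<open>\<not> f j \<tau> \<le> e\<close> show False by (metis linorder_neqE_linordered_idom
        less_irrefl less_le not_le)
  qed
  have ek: "f k \<tau> = e" using le[OF k(1)] k by simp
  have "f' k \<tau> < 0"
    by (rule inward[OF k(1) \<tau>T]) (use ek e le in auto)
  from has_real_derivative_neg_dec_left[OF der[OF k(1) \<tau>T] this] obtain h where
    h: "h > 0" "\<And>y. y > 0 \<Longrightarrow> \<tau> - y \<in> {0..T} \<Longrightarrow> y < h \<Longrightarrow> f k \<tau> < f k (\<tau> - y)"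
    by blast
  define y where "y = min (h / 2) \<tau>"
  have "f k \<tau> < f k (\<tau> - y)" using h pos \<tau>T by (intro h(2)) (auto simp: y_def min_def)
  moreover have "f k (\<tau> - y) < e" using h pos by (intro before k) (auto simp: y_def min_def)
  ultimately show False using ek by simp
qed

lemma barrier:
  fixes f f' :: "real \<Rightarrow> real"
  assumes "\<And>t. t \<in> {0..T} \<Longrightarrow> (f has_real_derivative f' t) (at t within {0..T})"
    and "\<And>t. t \<in> {0..T} \<Longrightarrow> c < f t \<Longrightarrow> f' t < 0"
    and "t \<in> {0..T}"
  shows "f t \<le> max (f 0) c"
  by (rule barrier_family[of "{()}" "max (f 0) c" "max (f 0) c + 1" T "\<lambda>_. f" "\<lambda>_. f'" "()" t])
     (use assms in auto)

lemma derivative_nonpos_nonincreasing: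
  fixes f f' :: "real \<Rightarrow> real"
  assumes der: "\<And>t. t \<in> {0..T} \<Longrightarrow> (f has_real_derivative f' t) (at t within {0..T})"
    and np: "\<And>t. t \<in> {0..T} \<Longrightarrow> f' t \<le> 0" and t: "t \<in> {0..T}"
  shows "f t \<le> f 0"
proof (cases "t = 0")
  case False
  then have "0 < t" using t by auto
  moreover have "(f has_derivative (*) (f' s)) (at s within {0..t})" if "s \<in> {0..t}" for s
    using has_field_derivative_subset[OF der[of s], of "{0..t}"] that t
    by (auto simp: has_field_derivative_def)
  ultimately obtain s where "s \<in> {0<..<t}" "f t - f 0 = f' s * (t - 0)"
    using mvt_simple[of 0 t f "\<lambda>s. (*) (f' s)"] by auto
  then show ?thesis using np[of s] t mult_nonpos_nonneg[of "f' s" t] by auto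
qed simp

text \<open>Statements such as ``all forward solutions from \<open>p\<close> stay below \<open>C\<close>'' become bounds on this set.
The existence time \<open>T\<close> is part of the set, so a bound never presupposes global existence.\<close>

definition reachable :: "('a::real_normed_vector \<Rightarrow> 'a) \<Rightarrow> 'a \<Rightarrow> 'a set"
  where "reachable F p = {x T | x T. T \<ge> 0 \<and> ode_solution F x {0..T} \<and> x 0 = p}"

lemma reachableI:
  assumes "ode_solution F x I" "{0..t} \<subseteq> I" "0 \<le> t"
  shows "x t \<in> reachable F (x 0)"
  using ode_solution_subset[OF assms(1,2)] assms(3) by (auto simp: reachable_def)

section \<open>Global existence\<close>

lemma at_within_Ici_eq_Icc:
  fixes t :: real
  assumes "0 \<le> t" "t < b"
  shows "at t within {0..b} = at t within {0..}"
  by (rule at_within_nhd[of _ "{..<b}"]) (use assms in auto)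

lemma integral_has_vector_derivative_Ici:
  fixes g :: "real \<Rightarrow> 'a::euclidean_space"
  assumes "continuous_on {0..} g" "0 \<le> t"
  shows "((\<lambda>t. integral {0..t} g) has_vector_derivative g t) (at t within {0..})"
  using integral_has_vector_derivative[of 0 "t + 1" g t] assms
    at_within_Ici_eq_Icc[of t "t + 1"] continuous_on_subset[OF assms(1), of "{0..t+1}"]
  by auto

text \<open>Picard iteration on the whole half line at once. The unknown is \<open>z t = exp (- k t) (x t - p)\<close>
with \<open>k = 2 (L + 1)\<close>: this exponential weight makes the integral operator a contraction with
factor \<open>L / k < 1 / 2\<close> on bounded continuous functions, so no continuation of local
solutions is needed.\<close>

lemma bounded_lipschitz_global_solution:
  fixes G :: "'a::euclidean_space \<Rightarrow> 'a"
  assumes lip: "L-lipschitz_on UNIV G" and bd: "\<And>z. norm (G z) \<le> M"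
  shows "\<exists>x. ode_solution G x {0..} \<and> x 0 = p"
proof -
  define k where "k = 2 * (L + 1)"
  have L0: "L \<ge> 0" using lip lipschitz_on_nonneg by blast
  have k0: "k > 0" using L0 by (simp add: k_def)
  have M0: "M \<ge> 0" using bd[of p] norm_ge_zero order_trans by blast
  have Gcont: "continuous_on A G" for A
    using lipschitz_on_continuous_on[OF lip] continuous_on_subset by blast
  define \<phi> where "\<phi> z = (\<lambda>s. G (p + exp (k * s) *\<^sub>R apply_bcontfun z s))" for z
  define h where "h z t = integral {0..t} (\<phi> z)" for z t
  \<comment> \<open>Bounded continuous functions live on all of \<open>\<real>\<close>; negative times are collapsed to \<open>0\<close>.\<close>
  define g where "g z t = exp (- (k * max 0 t)) *\<^sub>R h z (max 0 t)" for z t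
  have \<phi>cont: "continuous_on A (\<phi> z)" for A z
    unfolding \<phi>_def
    by (intro continuous_on_compose2[OF Gcont[of UNIV]] continuous_intros
        continuous_on_subset[OF continuous_on_apply_bcontfun]) auto
  have \<phi>int: "\<phi> z integrable_on {0..t}" for z t
    using \<phi>cont by (rule integrable_continuous_real)
  have hder: "(h z has_vector_derivative \<phi> z t) (at t within {0..})" if "0 \<le> t" for z t
    unfolding h_def using \<phi>cont that by (rule integral_has_vector_derivative_Ici)
  have hcont: "continuous_on {0..} (h z)" for z
    unfolding continuous_on_eq_continuous_within
    using hder by (auto intro: has_vector_derivative_continuous)
  have hbound: "norm (h z t) \<le> M * t" if "0 \<le> t" for z t
    unfolding h_def
    using integral_bound[of 0 t "\<phi> z" M] that \<phi>cont bd by (auto simp: \<phi>_def)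
  have gcont: "continuous_on UNIV (g z)" for z
    unfolding g_def
    by (intro continuous_intros continuous_on_compose2[OF hcont]) (auto simp: le_max_iff_disj)
  have gbound: "norm (g z t) \<le> M / k" for z t
  proof -
    define m where "m = max 0 t"
    have "k * m \<le> exp (k * m)" using exp_ge_add_one_self[of "k * m"] by linarith
    then have "M * (k * m) \<le> M * exp (k * m)" using M0 by (rule mult_left_mono)
    then have "exp (- (k * m)) * (M * m) \<le> M / k"
      using k0 by (simp add: exp_minus field_simps)
    moreover have "norm (g z t) \<le> exp (- (k * m)) * (M * m)"
      unfolding g_def using hbound[of m z] by (simp add: m_def)
    ultimately show ?thesis by linarith
  qed
  define P where "P z = Bcontfun (g z)" for z
  have P: "apply_bcontfun (P z) = g z" for z
    unfolding P_def
    by (rule Bcontfun_inverse) (auto simp: bcontfun_def gcont bounded_iff intro!: exI[of _ "M / k"] gbound)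
  have contr: "dist (P z) (P w) \<le> 1/2 * dist z w" for z w
  proof (rule dist_bound)
    fix t :: real
    define m where "m = max 0 t"
    have m: "m \<ge> 0" by (simp add: m_def)
    define D where "D = dist z w"
    have D0: "D \<ge> 0" by (simp add: D_def)
    have pt: "norm (\<phi> z s - \<phi> w s) \<le> L * D * exp (k * s)" for s
    proof -
      have "norm (\<phi> z s - \<phi> w s) \<le> L * norm (exp (k * s) *\<^sub>R (z s - w s))"
        using lipschitz_on_normD[OF lip, of "p + exp (k * s) *\<^sub>R z s" "p + exp (k * s) *\<^sub>R w s"]
        by (simp add: \<phi>_def algebra_simps)
      also have "\<dots> \<le> L * (exp (k * s) * D)"
        using dist_bounded[of z s w] L0
        by (auto simp: dist_norm D_def intro!: mult_left_mono)
      finally show ?thesis by (simp add: mult_ac)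
    qed
    have ei: "((\<lambda>s. L * D * exp (k * s)) has_integral
        (L * D * exp (k * m) / k - L * D * exp (k * 0) / k)) {0..m}"
      by (rule fundamental_theorem_of_calculus[OF m])
        (use k0 in \<open>auto intro!: derivative_eq_intros
           simp: has_real_derivative_iff_has_vector_derivative[symmetric]\<close>)
    have "norm (h z m - h w m) = norm (integral {0..m} (\<lambda>s. \<phi> z s - \<phi> w s))"
      by (simp add: h_def integral_diff \<phi>int)
    also have "\<dots> \<le> integral {0..m} (\<lambda>s. L * D * exp (k * s))"
      by (rule integral_norm_bound_integral)
        (use pt ei in \<open>auto intro: integrable_diff \<phi>int\<close>)
    also have "\<dots> \<le> L * D * exp (k * m) / k"
      unfolding integral_unique[OF ei] using k0 L0 D0 by simp
    finally have "norm (h z m - h w m) \<le> L * D * exp (k * m) / k" .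
    then have "exp (- (k * m)) * norm (h z m - h w m) \<le> exp (- (k * m)) * (L * D * exp (k * m) / k)"
      by (intro mult_left_mono) auto
    also have "\<dots> = L / k * D" by (simp add: exp_minus field_simps)
    also have "\<dots> \<le> 1/2 * D"
      using k0 L0 D0 by (intro mult_right_mono) (auto simp: k_def field_simps)
    finally show "dist (P z t) (P w t) \<le> 1/2 * dist z w"
      by (simp add: P g_def dist_norm D_def m_def scaleR_diff_right[symmetric])
  qed
  have "\<exists>!z. P z = z"
    using banach_fix_type[of "1/2" P] contr by (auto simp: )
  then obtain z where z: "P z = z" by auto
  define y where "y t = p + h z t" for t
  have y: "p + exp (k * t) *\<^sub>R z t = y t" if "0 \<le> t" for t
  proof -
    have "z t = g z t" using P[of z] z by simp
    then show ?thesis using that by (simp add: g_def y_def exp_minus)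
  qed
  have "ode_solution G y {0..}"
    unfolding ode_solution_def
  proof
    fix t :: real assume "t \<in> {0..}"
    then have "(y has_vector_derivative \<phi> z t) (at t within {0..})"
      unfolding y_def using hder[of t z] by (auto intro!: derivative_eq_intros)
    then show "(y has_vector_derivative G (y t)) (at t within {0..})"
      using y[of t] \<open>t \<in> {0..}\<close> by (simp add: \<phi>_def)
  qed
  moreover have "y 0 = p" by (simp add: y_def h_def)
  ultimately show ?thesis by blast
qed

text \<open>Precomposing with the projection onto a large ball makes the field bounded and globally
Lipschitz. The global solution of the truncated field solves the original equation as long as
it stays in the ball, and at the first time on the sphere it would be a reachable point of norm
\<open>R\<close>, which \<open>R\<close> was chosen to exclude.\<close>

lemma global_solution_if_reachable_bounded:
  fixes F :: "'a::euclidean_space \<Rightarrow> 'a"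
  assumes lip: "\<And>R. \<exists>L. L-lipschitz_on (cball 0 R) F"
    and bd: "bounded (reachable F p)"
  shows "\<exists>x. ode_solution F x {0..} \<and> x 0 = p"
proof -
  obtain R where R: "R > 0" "\<And>z. z \<in> reachable F p \<Longrightarrow> norm z < R"
    using bd bounded_pos_less by blast
  obtain L where L: "L-lipschitz_on (cball 0 R) F" using lip by blast
  define c where "c = closest_point (cball (0::'a) R)"
  have c: "c z \<in> cball 0 R" for z
    using R unfolding c_def by (intro closest_point_in_set) auto
  have "1-lipschitz_on UNIV c"
    unfolding c_def using R
    by (intro lipschitz_onI) (auto intro!: closest_point_lipschitz)
  from lipschitz_on_compose2[OF this] L have G: "L-lipschitz_on UNIV (\<lambda>z. F (c z))"
    using c lipschitz_on_subset[of L "cball 0 R" F "c ` UNIV"] by (auto simp: image_subset_iff)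
  have "compact (F ` cball 0 R)"
    by (intro compact_continuous_image lipschitz_on_continuous_on[OF L]) auto
  then obtain M where "\<And>z. z \<in> cball 0 R \<Longrightarrow> norm (F z) \<le> M"
    using compact_imp_bounded bounded_iff by (metis imageI)
  with bounded_lipschitz_global_solution[OF G, of M p] c obtain y where
    y: "ode_solution (\<lambda>z. F (c z)) y {0..}" "y 0 = p" by blast
  have ycont: "continuous_on {0..} y" using y by (simp add: ode_solution_continuous_on)
  have cid: "c z = z" if "norm z \<le> R" for z
    unfolding c_def using that by (intro closest_point_self) auto
  have solF: "ode_solution F y {0..t}" if "\<And>s. s \<in> {0..t} \<Longrightarrow> norm (y s) \<le> R" for t
    using ode_solution_subset[OF y(1), of "{0..t}"] cid that
    unfolding ode_solution_def by auto
  have p: "norm p < R"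
    using R(2)[of p] y(2) reachableI[of F "\<lambda>_. p" "{0..0}" 0]
    by (auto simp: ode_solution_def has_vector_derivative_def has_derivative_within_singleton_iff
      bounded_linear_scaleR_left)
  have bound: "norm (y t) < R" if "t \<ge> 0" for t
  proof (rule ccontr)
    assume "\<not> norm (y t) < R"
    define S where "S = {s \<in> {0..t}. R \<le> norm (y s)}"
    have "closed S" unfolding S_def
      by (rule continuous_on_closed_Collect_le)
        (auto intro!: continuous_intros continuous_on_subset[OF ycont])
    then have "compact S"
      by (auto simp: compact_eq_bounded_closed S_def intro: bounded_subset[OF bounded_closed_interval])
    moreover have "t \<in> S" using that \<open>\<not> norm (y t) < R\<close> by (auto simp: S_def)
    ultimately obtain \<tau> where \<tau>: "\<tau> \<in> S" "\<And>s. s \<in> S \<Longrightarrow> \<tau> \<le> s"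
      using compact_attains_inf[of S] by blast
    have \<tau>0: "\<tau> \<ge> 0" "\<tau> \<le> t" "R \<le> norm (y \<tau>)" using \<tau> by (auto simp: S_def)
    have before: "norm (y s) < R" if "0 \<le> s" "s < \<tau>" for s
      using \<tau>(2)[of s] that \<tau>0 by (force simp: S_def)
    have "norm (y \<tau>) \<le> R"
    proof (rule ccontr)
      assume *: "\<not> norm (y \<tau>) \<le> R"
      then have "\<exists>s\<ge>0. s \<le> \<tau> \<and> norm (y s) = R"
        using p y(2) \<tau>0
        by (intro IVT') (auto intro!: continuous_intros continuous_on_subset[OF ycont])
      with before * show False by (metis less_irrefl less_le not_le order.order_iff_strict)
    qed
    then have "norm (y s) \<le> R" if "s \<in> {0..\<tau>}" for s
      using before[of s] that by (cases "s = \<tau>") auto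
    then have "y \<tau> \<in> reachable F p"
      using solF[of \<tau>] \<tau>0 y(2) by (auto simp: reachable_def)
    with R(2) \<tau>0 show False by force
  qed
  have "ode_solution F y {0..}"
    using y(1) cid bound unfolding ode_solution_def by (auto simp: less_imp_le)
  with y(2) show ?thesis by blast
qed

section \<open>Stability and attraction\<close>

text \<open>To leave the \<open>\<epsilon>\<close>-ball a solution has to cross its sphere, on which \<open>V\<close> is at least its positive
minimum; starting below that minimum this is impossible. Monotonicity is stated along
solutions rather than through a gradient, so that \<open>V\<close> may be a maximum of squares.\<close>

lemma lyapunov_stable_if_nonincreasing_along_solutions:
  fixes V :: "'a::euclidean_space \<Rightarrow> real"
  assumes cont: "continuous_on UNIV V"
    and zero: "V 0 = 0" and pos: "\<And>z. z \<noteq> 0 \<Longrightarrow> V z > 0"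
    and dec: "\<And>x T. 0 \<le> T \<Longrightarrow> ode_solution F x {0..T} \<Longrightarrow> V (x T) \<le> V (x 0)"
  shows "lyapunov_stable F 0"
  unfolding lyapunov_stable_def
proof (intro allI impI)
  fix \<epsilon> :: real assume "0 < \<epsilon>"
  have "sphere (0::'a) \<epsilon> \<noteq> {}"
    using vector_choose_size[of \<epsilon>] \<open>0 < \<epsilon>\<close> by fastforce
  then obtain w where w: "w \<in> sphere 0 \<epsilon>" "\<And>z. z \<in> sphere 0 \<epsilon> \<Longrightarrow> V w \<le> V z"
    using continuous_attains_inf[OF compact_sphere _ continuous_on_subset[OF cont subset_UNIV]]
    by metis
  have "V w > 0" using w \<open>0 < \<epsilon>\<close> by (intro pos) auto
  moreover have "isCont V 0" using cont by (simp add: continuous_on_eq_continuous_at)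
  ultimately obtain \<delta> where \<delta>: "\<delta> > 0" "\<And>z. dist z 0 < \<delta> \<Longrightarrow> dist (V z) (V 0) < V w"
    unfolding continuous_at_eps_delta by meson
  have "dist (x t) 0 < \<epsilon>"
    if T: "0 \<le> T" and x: "ode_solution F x {0..T}" and x0: "dist (x 0) 0 < min \<delta> \<epsilon>"
      and t: "t \<in> {0..T}" for x T t
  proof (rule ccontr)
    assume *: "\<not> dist (x t) 0 < \<epsilon>"
    have "\<exists>s\<ge>0. s \<le> t \<and> norm (x s) = \<epsilon>"
      using * x0 t ode_solution_continuous_on[OF x]
      by (intro IVT') (auto intro!: continuous_intros elim: continuous_on_subset)
    then obtain s where s: "0 \<le> s" "s \<le> t" "norm (x s) = \<epsilon>" by blast
    have "V w \<le> V (x s)" using s by (intro w) auto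
    also have "\<dots> \<le> V (x 0)"
      using s t by (intro dec ode_solution_subset[OF x]) auto
    also have "\<dots> < V w" using \<delta>(2)[of "x 0"] x0 zero by (auto simp: dist_real_def)
    finally show False by simp
  qed
  then show "\<exists>\<delta>>0. \<forall>T\<ge>0. \<forall>x. ode_solution F x {0..T} \<and> dist (x 0) 0 < \<delta> \<longrightarrow>
      (\<forall>t\<in>{0..T}. dist (x t) 0 < \<epsilon>)"
    using \<delta>(1) \<open>0 < \<epsilon>\<close> by (intro exI[of _ "min \<delta> \<epsilon>"]) auto
qed

lemma globally_asymptotically_stable_criterion:
  fixes F :: "'a::euclidean_space \<Rightarrow> 'a"
  assumes "F 0 = 0" and "\<And>R. \<exists>L. L-lipschitz_on (cball 0 R) F"
    and "lyapunov_stable F 0" and "\<And>p. bounded (reachable F p)"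
    and "\<And>x. ode_solution F x {0..} \<Longrightarrow> (x \<longlongrightarrow> 0) at_top"
  shows "globally_asymptotically_stable F 0"
  using assms global_solution_if_reachable_bounded[OF assms(2,4)]
  unfolding globally_asymptotically_stable_def global_attractor_def attracts_point_def
  by (auto simp: dist_norm intro!: tendsto_norm_zero)

text \<open>Stability forces a solution starting at \<open>p\<close> to stay within every \<open>\<epsilon>\<close> of \<open>p\<close>, which is the forward
invariance of \<open>{p}\<close>.\<close>

lemma permanent_if_globally_asymptotically_stable:
  fixes F :: "'a::real_normed_vector \<Rightarrow> 'a"
  assumes "globally_asymptotically_stable F p"
  shows "permanent F"
  unfolding permanent_def
proof (intro exI conjI)
  have ls: "lyapunov_stable F p" and ga: "global_attractor F {p}"
    using assms by (auto simp: globally_asymptotically_stable_def)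
  show "global_attractor F {p}" "compact {p}" using ga by auto
  show "forward_invariant F {p}"
    unfolding forward_invariant_def
  proof (intro allI impI ballI)
    fix T t :: real and x
    assume *: "0 \<le> T" "ode_solution F x {0..T} \<and> x 0 \<in> {p}" "t \<in> {0..T}"
    have "dist (x t) p < \<epsilon>" if \<epsilon>: "\<epsilon> > 0" for \<epsilon>
    proof -
      obtain \<delta> where \<delta>: "\<delta> > 0" "\<forall>T\<ge>0. \<forall>x. ode_solution F x {0..T} \<and> dist (x 0) p < \<delta> \<longrightarrow>
          (\<forall>t\<in>{0..T}. dist (x t) p < \<epsilon>)"
        using ls[unfolded lyapunov_stable_def, rule_format, OF \<epsilon>] by blast
      show ?thesis
        using \<delta>(2)[rule_format, OF *(1), of x t] * \<delta>(1) by simp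
    qed
    from this[of "dist (x t) p"] show "x t \<in> {p}" by auto
  qed
qed

text \<open>Every obstruction to permanence is derived from this fact. A solution that keeps \<open>V \<ge> c\<close> enters
the compact \<open>1\<close>-neighbourhood of the attractor, on which \<open>V\<close> is bounded by a constant that does
not depend on the solution.\<close>

lemma permanent_bounds_persistent_levels:
  fixes F :: "'a::euclidean_space \<Rightarrow> 'a"
  assumes "permanent F" and V: "continuous_on UNIV V"
  obtains C :: real where
    "\<And>x c. ode_solution F x {0..} \<Longrightarrow> (\<And>t. 0 \<le> t \<Longrightarrow> c \<le> V (x t)) \<Longrightarrow> c \<le> C"
proof -
  obtain K where K: "compact K" "global_attractor F K" using assms by (auto simp: permanent_def)
  define N where "N = {z. infdist z K \<le> 1}"
  have "compact N" unfolding N_def using K by (intro compact_infdist_le) (auto simp: global_attractor_def)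
  then have "compact (V ` N)"
    by (intro compact_continuous_image continuous_on_subset[OF V]) auto
  then obtain C where C: "\<And>z. z \<in> N \<Longrightarrow> V z \<le> C"
    using bounded_imp_bdd_above[OF compact_imp_bounded] unfolding bdd_above_def by (metis imageI)
  have "c \<le> C" if x: "ode_solution F x {0..}" and c: "\<And>t. 0 \<le> t \<Longrightarrow> c \<le> V (x t)" for x c
  proof -
    have "((\<lambda>t. infdist (x t) K) \<longlongrightarrow> 0) at_top"
      using K(2) x by (auto simp: global_attractor_def attracts_point_def)
    then have "\<forall>\<^sub>F t in at_top. infdist (x t) K < 1" by (rule order_tendstoD) simp
    moreover have "\<forall>\<^sub>F t in at_top. (0::real) \<le> t" by (rule eventually_ge_at_top)
    ultimately have "\<forall>\<^sub>F t in at_top. infdist (x t) K < 1 \<and> 0 \<le> t" by (rule eventually_conj)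
    then obtain t where "infdist (x t) K < 1" "0 \<le> t"
      using eventually_happens'[OF trivial_limit_at_top_linorder] by blast
    then show ?thesis using c[of t] C[of "x t"] by (simp add: N_def)
  qed
  then show ?thesis by (rule that)
qed

lemma permanent_global_solution:
  assumes "permanent F"
  obtains x where "ode_solution F x {0..}" "x 0 = p"
  using assms by (auto simp: permanent_def global_attractor_def attracts_point_def)

text \<open>Barbalat's lemma: over a window of fixed length \<open>h\<close> the increments of \<open>f\<close> tend to \<open>0\<close>, so by the
mean value theorem \<open>\<phi>\<close> is small somewhere in the window, and by uniform continuity at its left
end. It replaces the invariance principle, which would need continuous dependence on
initial values.\<close>

lemma barbalat:
  fixes f \<phi> :: "real \<Rightarrow> real"
  assumes der: "\<And>t. 0 \<le> t \<Longrightarrow> (f has_real_derivative \<phi> t) (at t within {0..})"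
    and uc: "uniformly_continuous_on {0..} \<phi>" and lim: "(f \<longlongrightarrow> l) at_top"
  shows "(\<phi> \<longlongrightarrow> 0) at_top"
proof (rule tendstoI)
  fix \<epsilon> :: real assume "0 < \<epsilon>"
  obtain \<delta> where \<delta>: "\<delta> > 0"
    "\<And>s t. 0 \<le> s \<Longrightarrow> 0 \<le> t \<Longrightarrow> dist s t < \<delta> \<Longrightarrow> dist (\<phi> s) (\<phi> t) < \<epsilon> / 2"
    using uc \<open>0 < \<epsilon>\<close> unfolding uniformly_continuous_on_def
    by (metis atLeast_iff half_gt_zero)
  define h where "h = \<delta> / 2"
  have h: "0 < h" "h < \<delta>" using \<delta> by (auto simp: h_def)
  have "\<forall>\<^sub>F t in at_top. dist (f t) l < \<epsilon> * h / 4"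
    using lim \<open>0 < \<epsilon>\<close> h by (intro tendstoD) auto
  then obtain T where T: "\<And>t. T \<le> t \<Longrightarrow> dist (f t) l < \<epsilon> * h / 4"
    by (auto simp: eventually_at_top_linorder)
  have "dist (\<phi> t) 0 < \<epsilon>" if "max T 0 \<le> t" for t
  proof -
    have t: "0 \<le> t" "T \<le> t" using that by auto
    have "(f has_derivative (*) (\<phi> s)) (at s within {t..t+h})" if "s \<in> {t..t+h}" for s
      using has_field_derivative_subset[OF der[of s], of "{t..t+h}"] that t
      by (auto simp: has_field_derivative_def)
    then obtain s where s: "s \<in> {t<..<t+h}" "f (t + h) - f t = \<phi> s * h"
      using mvt_simple[of t "t + h" f "\<lambda>s. (*) (\<phi> s)"] h by auto
    have "\<bar>\<phi> s\<bar> * h = \<bar>f (t + h) - f t\<bar>" using s h by (simp add: abs_mult)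
    also have "\<dots> < \<epsilon> / 2 * h"
    proof -
      have "\<bar>f t - l\<bar> < \<epsilon> * h / 4" "\<bar>f (t + h) - l\<bar> < \<epsilon> * h / 4"
        using T[of t] T[of "t + h"] t h by (auto simp: dist_real_def)
      then show ?thesis by (auto simp: abs_if field_simps split: if_splits)
    qed
    finally have "\<bar>\<phi> s\<bar> < \<epsilon> / 2" using h by simp
    moreover have "dist (\<phi> s) (\<phi> t) < \<epsilon> / 2"
      using s t h by (intro \<delta>) (auto simp: dist_real_def)
    ultimately show ?thesis using dist_triangle[of "\<phi> t" 0 "\<phi> s"] by (simp add: dist_commute)
  qed
  then show "\<forall>\<^sub>F t in at_top. dist (\<phi> t) 0 < \<epsilon>"
    unfolding eventually_at_top_linorder by blast
qed

lemma nonincreasing_bounded_below_convergent: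
  fixes f :: "real \<Rightarrow> real"
  assumes dec: "\<And>s t. 0 \<le> s \<Longrightarrow> s \<le> t \<Longrightarrow> f t \<le> f s" and bd: "\<And>t. 0 \<le> t \<Longrightarrow> b \<le> f t"
  obtains l where "(f \<longlongrightarrow> l) at_top"
proof
  define l where "l = Inf (f ` {0..})"
  have bdd: "bdd_below (f ` {0..})" using bd by (auto intro!: bdd_belowI)
  show "(f \<longlongrightarrow> l) at_top"
  proof (rule tendstoI)
    fix \<epsilon> :: real assume "0 < \<epsilon>"
    then have "Inf (f ` {0..}) < l + \<epsilon>" by (simp add: l_def)
    then obtain s where s: "0 \<le> s" "f s < l + \<epsilon>"
      using cInf_less_iff[OF _ bdd] by auto
    have "dist (f t) l < \<epsilon>" if "s \<le> t" for t
    proof -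
      have "l \<le> f t" unfolding l_def using that s by (intro cInf_lower bdd) auto
      moreover have "f t \<le> f s" using dec s that by blast
      ultimately show ?thesis using s by (simp add: dist_real_def)
    qed
    then show "\<forall>\<^sub>F t in at_top. dist (f t) l < \<epsilon>"
      unfolding eventually_at_top_linorder by blast
  qed
qed

lemma bounded_solution_uniformly_continuous:
  fixes F :: "'a::euclidean_space \<Rightarrow> 'a" and g :: "'a \<Rightarrow> real"
  assumes x: "ode_solution F x {0..}" and K: "compact K" "\<And>t. 0 \<le> t \<Longrightarrow> x t \<in> K"
    and F: "continuous_on K F" and g: "continuous_on K g"
  shows "uniformly_continuous_on {0..} (\<lambda>t. g (x t))"
proof -
  have "compact (F ` K)" using F K by (intro compact_continuous_image)
  then obtain M where M: "\<And>z. z \<in> K \<Longrightarrow> norm (F z) \<le> M"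
    using compact_imp_bounded bounded_iff by (metis imageI)
  have "norm (x s - x t) \<le> M * norm (s - t)" if "s \<in> {0..}" "t \<in> {0..}" for s t
  proof (rule differentiable_bound[of "{0..}" x "\<lambda>t h. h *\<^sub>R F (x t)"])
    fix r :: real assume r: "r \<in> {0..}"
    show "(x has_derivative (\<lambda>h. h *\<^sub>R F (x r))) (at r within {0..})"
      using x r by (auto simp: ode_solution_def has_vector_derivative_def)
    show "onorm (\<lambda>h. h *\<^sub>R F (x r)) \<le> M"
      using M[OF K(2)[of r]] r
      by (intro onorm_le) (auto simp: mult.commute[of M] intro: mult_left_mono)
  qed (use that in auto)
  then have "M-lipschitz_on {0..} x"
    using M[OF K(2)[of 0]] norm_ge_zero order_trans
    by (intro lipschitz_onI) (auto simp: dist_norm intro: order_trans[OF norm_ge_zero])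
  then have "uniformly_continuous_on {0..} x" by (rule lipschitz_on_uniformly_continuous)
  moreover have "uniformly_continuous_on (x ` {0..}) g"
    using compact_uniformly_continuous[OF g K(1)] K(2)
    unfolding uniformly_continuous_on_def by (metis (no_types, lifting) atLeast_iff imageE)
  ultimately show ?thesis by (rule uniformly_continuous_on_compose)
qed

text \<open>Where \<open>h\<close> is not small, \<open>g\<close> is bounded away from \<open>0\<close> by compactness.\<close>

lemma tendsto_zero_on_compact:
  fixes g :: "'a::metric_space \<Rightarrow> real" and h :: "'a \<Rightarrow> 'b::real_normed_vector"
  assumes K: "compact K" "\<And>t::real. 0 \<le> t \<Longrightarrow> x t \<in> K"
    and g: "continuous_on K g" and h: "continuous_on K h"
    and zero: "\<And>z. z \<in> K \<Longrightarrow> g z = 0 \<Longrightarrow> h z = 0"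
    and lim: "((\<lambda>t. g (x t)) \<longlongrightarrow> 0) at_top"
  shows "((\<lambda>t. h (x t)) \<longlongrightarrow> 0) at_top"
proof (rule tendstoI)
  fix \<epsilon> :: real assume "0 < \<epsilon>"
  define S where "S = {z \<in> K. \<epsilon> \<le> norm (h z)}"
  have "closed S" unfolding S_def
    using K h by (intro continuous_on_closed_Collect_le continuous_intros compact_imp_closed) auto
  then have "compact (K \<inter> S)" by (rule compact_Int_closed[OF K(1)])
  also have "K \<inter> S = S" by (auto simp: S_def)
  finally have S: "compact S" .
  obtain m where m: "m > 0" "\<And>z. z \<in> S \<Longrightarrow> m \<le> \<bar>g z\<bar>"
  proof (cases "S = {}")
    case False
    have "continuous_on S (\<lambda>z. \<bar>g z\<bar>)"
      by (intro continuous_intros continuous_on_subset[OF g]) (auto simp: S_def)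
    then obtain w where "w \<in> S" "\<And>z. z \<in> S \<Longrightarrow> \<bar>g w\<bar> \<le> \<bar>g z\<bar>"
      using continuous_attains_inf[OF S False] by metis
    moreover from this have "g w \<noteq> 0" using zero[of w] \<open>0 < \<epsilon>\<close> by (auto simp: S_def)
    ultimately show ?thesis using that[of "\<bar>g w\<bar>"] by auto
  qed (use that[of 1] in auto)
  have "\<forall>\<^sub>F t in at_top. dist (g (x t)) 0 < m" using lim m(1) by (rule tendstoD)
  moreover have "\<forall>\<^sub>F t in at_top. (0::real) \<le> t" by (rule eventually_ge_at_top)
  ultimately show "\<forall>\<^sub>F t in at_top. dist (h (x t)) 0 < \<epsilon>"
  proof eventually_elim
    case (elim t)
    then have "x t \<notin> S" using m(2)[of "x t"] by (auto simp: dist_real_def)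
    then show ?case using K(2)[OF elim(2)] by (auto simp: S_def)
  qed
qed

section \<open>Change of coordinates\<close>

lemma ode_solution_linear_image:
  fixes T :: "'a::euclidean_space \<Rightarrow> 'a"
  assumes "linear T" "\<And>z. G (T z) = T (F z)" "ode_solution F x I"
  shows "ode_solution G (\<lambda>t. T (x t)) I"
  using assms bounded_linear.has_vector_derivative[of T]
  by (auto simp: ode_solution_def linear_conv_bounded_linear)

lemma orthogonal_transformation_inverse:
  fixes T :: "'a::euclidean_space \<Rightarrow> 'a"
  assumes "orthogonal_transformation T"
  shows "T (inv T z) = z" "inv T (T z) = z" "linear T" "linear (inv T)"
    "norm (T z) = norm z" "norm (inv T z) = norm z" "dist (T z) (T w) = dist z w"
  using assms orthogonal_transformation_inv[OF assms]
  by (auto simp: orthogonal_transformation_surj surj_f_inv_f orthogonal_transformation_inj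
      orthogonal_transformation_linear orthogonal_transformation_norm
      orthogonal_transformation_isometry)

context
  fixes T F G :: "'a::euclidean_space \<Rightarrow> 'a"
  assumes T: "orthogonal_transformation T" and conj: "\<And>z. G (T z) = T (F z)"
begin

lemma conjugate_pullback:
  assumes "ode_solution G y I"
  shows "ode_solution F (\<lambda>t. inv T (y t)) I"
proof (rule ode_solution_linear_image[OF _ _ assms])
  show "F (inv T z) = inv T (G z)" for z
    using conj[of "inv T z"] orthogonal_transformation_inverse[OF T] by metis
qed (rule orthogonal_transformation_inverse[OF T])

lemma infdist_conjugate: "infdist (T z) (T ` K) = infdist z K"
  by (simp add: infdist_def image_image orthogonal_transformation_inverse[OF T])

lemma global_attractor_conjugate:
  assumes "global_attractor F K"
  shows "global_attractor G (T ` K)"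
  unfolding global_attractor_def attracts_point_def
proof (intro conjI allI impI)
  note inv = orthogonal_transformation_inverse[OF T]
  show "T ` K \<noteq> {}" using assms by (auto simp: global_attractor_def)
  fix p
  obtain x where x: "ode_solution F x {0..}" "x 0 = inv T p"
    using assms by (auto simp: global_attractor_def attracts_point_def)
  then show "\<exists>y. ode_solution G y {0..} \<and> y 0 = p"
    using ode_solution_linear_image[OF inv(3) conj x(1)] inv(1)
    by (intro exI[of _ "\<lambda>t. T (x t)"]) auto
  fix y assume "ode_solution G y {0..} \<and> y 0 = p"
  then have "((\<lambda>t. infdist (inv T (y t)) K) \<longlongrightarrow> 0) at_top"
    using assms conjugate_pullback[of y "{0..}"]
    by (auto simp: global_attractor_def attracts_point_def)
  then show "((\<lambda>t. infdist (y t) (T ` K)) \<longlongrightarrow> 0) at_top"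
    using infdist_conjugate[of "inv T (y t)" K for t] inv(1) by simp
qed

lemma permanent_conjugate:
  assumes "permanent F"
  shows "permanent G"
proof -
  note inv = orthogonal_transformation_inverse[OF T]
  obtain K where K: "compact K" "forward_invariant F K" "global_attractor F K"
    using assms by (auto simp: permanent_def)
  have "forward_invariant G (T ` K)"
    unfolding forward_invariant_def
  proof (intro allI impI ballI)
    fix t' t :: real and y
    assume *: "0 \<le> t'" "ode_solution G y {0..t'} \<and> y 0 \<in> T ` K" "t \<in> {0..t'}"
    have "ode_solution F (\<lambda>t. inv T (y t)) {0..t'}" "inv T (y 0) \<in> K"
      using * conjugate_pullback[of y "{0..t'}"] inv(2) by auto
    with K(2)[unfolded forward_invariant_def, rule_format, of t' "\<lambda>t. inv T (y t)" t] *
    have "inv T (y t) \<in> K" by blast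
    then have "T (inv T (y t)) \<in> T ` K" by (rule imageI)
    then show "y t \<in> T ` K" by (simp only: inv(1))
  qed
  moreover have "compact (T ` K)" by (intro compact_continuous_image linear_continuous_on K)
      (use inv(3) in \<open>simp add: linear_conv_bounded_linear\<close>)
  ultimately show ?thesis
    using global_attractor_conjugate[OF K(3)] by (auto simp: permanent_def)
qed

lemma globally_asymptotically_stable_conjugate:
  assumes "globally_asymptotically_stable F 0"
  shows "globally_asymptotically_stable G 0"
proof -
  note inv = orthogonal_transformation_inverse[OF T]
  have T0: "T 0 = 0" using inv(3) by (rule linear_0)
  have "lyapunov_stable G 0"
    unfolding lyapunov_stable_def
  proof (intro allI impI)
    fix \<epsilon> :: real assume "0 < \<epsilon>"
    have "lyapunov_stable F 0" using assms by (simp add: globally_asymptotically_stable_def)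
    from this[unfolded lyapunov_stable_def, rule_format, OF \<open>0 < \<epsilon>\<close>]
    obtain \<delta> where \<delta>: "\<delta> > 0"
      "\<forall>t'\<ge>0. \<forall>x. ode_solution F x {0..t'} \<and> dist (x 0) 0 < \<delta> \<longrightarrow>
         (\<forall>t\<in>{0..t'}. dist (x t) 0 < \<epsilon>)"
      by blast
    have "dist (y t) 0 < \<epsilon>"
      if "t' \<ge> 0" "ode_solution G y {0..t'}" "dist (y 0) 0 < \<delta>" "t \<in> {0..t'}" for t' y t
      using \<delta>(2)[rule_format, OF that(1), of "\<lambda>t. inv T (y t)" t]
        conjugate_pullback[OF that(2)] that(3,4) by (simp add: inv(6))
    then show "\<exists>\<delta>>0. \<forall>t'\<ge>0. \<forall>y. ode_solution G y {0..t'} \<and> dist (y 0) 0 < \<delta> \<longrightarrow>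
        (\<forall>t\<in>{0..t'}. dist (y t) 0 < \<epsilon>)"
      using \<delta>(1) by blast
  qed
  moreover have "global_attractor G {0}"
    using global_attractor_conjugate[of "{0}"] assms T0
    by (simp add: globally_asymptotically_stable_def)
  moreover have "G 0 = 0"
    using conj[of 0] assms T0 by (simp add: globally_asymptotically_stable_def)
  ultimately show ?thesis by (simp add: globally_asymptotically_stable_def)
qed

end

section \<open>The exponential planar field\<close>

lemma exp_field_nth:
  "exp_field a1 a2 a3 a4 b1 b2 b3 b4 w $ 1
     = exp (a1 * w $ 1 + b1 * w $ 2) - exp (a2 * w $ 1 + b2 * w $ 2)"
  "exp_field a1 a2 a3 a4 b1 b2 b3 b4 w $ 2
     = exp (a3 * w $ 1 + b3 * w $ 2) - exp (a4 * w $ 1 + b4 * w $ 2)"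
  by (simp_all add: exp_field_def Let_def)

lemma exp_field_sign:
  "exp_field a1 a2 a3 a4 b1 b2 b3 b4 w $ 1 < 0 \<longleftrightarrow> (a1 - a2) * w $ 1 + (b1 - b2) * w $ 2 < 0"
  "exp_field a1 a2 a3 a4 b1 b2 b3 b4 w $ 1 > 0 \<longleftrightarrow> (a1 - a2) * w $ 1 + (b1 - b2) * w $ 2 > 0"
  "exp_field a1 a2 a3 a4 b1 b2 b3 b4 w $ 2 < 0 \<longleftrightarrow> (a3 - a4) * w $ 1 + (b3 - b4) * w $ 2 < 0"
  "exp_field a1 a2 a3 a4 b1 b2 b3 b4 w $ 2 > 0 \<longleftrightarrow> (a3 - a4) * w $ 1 + (b3 - b4) * w $ 2 > 0"
  by (auto simp: exp_field_nth algebra_simps)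

lemma exp_field_eq_0_iff:
  "exp_field a1 a2 a3 a4 b1 b2 b3 b4 w = 0 \<longleftrightarrow>
     (a1 - a2) * w $ 1 + (b1 - b2) * w $ 2 = 0 \<and> (a3 - a4) * w $ 1 + (b3 - b4) * w $ 2 = 0"
  by (auto simp: vec_eq_iff forall_2 exp_field_nth algebra_simps)

lemma norm_real_2_le: "norm (w :: real^2) \<le> \<bar>w $ 1\<bar> + \<bar>w $ 2\<bar>"
  using norm_le_l1_cart[of w] by (simp add: sum_2)

lemma exp_linear_lipschitz_on_cball:
  "\<exists>L. L-lipschitz_on (cball 0 R) (\<lambda>w::'a::euclidean_space. exp (c \<bullet> w))"
proof -
  define B where "B = norm c * exp (norm c * R)"
  have B0: "B \<ge> 0" by (simp add: B_def)
  have "norm (exp (c \<bullet> z) - exp (c \<bullet> w)) \<le> B * norm (z - w)"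
    if "z \<in> cball 0 R" "w \<in> cball 0 R" for z w :: 'a
  proof (rule differentiable_bound[of "cball 0 R" _ "\<lambda>w h. exp (c \<bullet> w) * (c \<bullet> h)"])
    fix w :: 'a assume w: "w \<in> cball 0 R"
    show "((\<lambda>w. exp (c \<bullet> w)) has_derivative (\<lambda>h. exp (c \<bullet> w) * (c \<bullet> h))) (at w within cball 0 R)"
      by (auto intro!: derivative_eq_intros)
    have "c \<bullet> w \<le> norm c * norm w" by (rule norm_cauchy_schwarz)
    also have "\<dots> \<le> norm c * R" using w by (intro mult_left_mono) auto
    finally have "exp (c \<bullet> w) \<le> exp (norm c * R)" by simp
    moreover have "\<bar>c \<bullet> h\<bar> \<le> norm c * norm h" for h by (rule Cauchy_Schwarz_ineq2)
    ultimately have "exp (c \<bullet> w) * \<bar>c \<bullet> h\<bar> \<le> exp (norm c * R) * (norm c * norm h)" for h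
      by (intro mult_mono) auto
    then show "onorm (\<lambda>h. exp (c \<bullet> w) * (c \<bullet> h)) \<le> B"
      by (intro onorm_le) (auto simp: B_def abs_mult mult_ac)
  qed (use that in auto)
  then show ?thesis
    using B0 by (intro exI[of _ B] lipschitz_onI) (auto simp: dist_norm)
qed

lemma exp_field_lipschitz_on_cball:
  "\<exists>L. L-lipschitz_on (cball 0 R) (exp_field a1 a2 a3 a4 b1 b2 b3 b4)"
proof -
  have lin: "\<exists>L. L-lipschitz_on (cball 0 R) (\<lambda>w::real^2. exp (a * w $ 1 + b * w $ 2))" for a b
    using exp_linear_lipschitz_on_cball[of R "vector [a, b] :: real^2"]
    by (simp add: inner_vec_def sum_2)
  have diff: "\<exists>L. L-lipschitz_on (cball 0 R)
      (\<lambda>w::real^2. exp (a * w $ 1 + b * w $ 2) - exp (c * w $ 1 + d * w $ 2))" for a b c d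
    using lin[of a b] lin[of c d] lipschitz_on_diff by blast
  obtain L1 L2 where L:
    "L1-lipschitz_on (cball 0 R) (\<lambda>w. exp_field a1 a2 a3 a4 b1 b2 b3 b4 w $ 1)"
    "L2-lipschitz_on (cball 0 R) (\<lambda>w. exp_field a1 a2 a3 a4 b1 b2 b3 b4 w $ 2)"
    unfolding exp_field_nth using diff by meson
  have "(L1 + L2)-lipschitz_on (cball 0 R) (exp_field a1 a2 a3 a4 b1 b2 b3 b4)"
  proof (rule lipschitz_onI)
    fix z w :: "real^2" assume "z \<in> cball 0 R" "w \<in> cball 0 R"
    with lipschitz_onD[OF L(1)] lipschitz_onD[OF L(2)]
      norm_real_2_le[of "exp_field a1 a2 a3 a4 b1 b2 b3 b4 z - exp_field a1 a2 a3 a4 b1 b2 b3 b4 w"]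
    show "dist (exp_field a1 a2 a3 a4 b1 b2 b3 b4 z) (exp_field a1 a2 a3 a4 b1 b2 b3 b4 w)
        \<le> (L1 + L2) * dist z w"
      unfolding dist_norm real_norm_def vector_minus_component distrib_right by fastforce
  next
    show "0 \<le> L1 + L2" using L lipschitz_on_nonneg by (metis add_nonneg_nonneg)
  qed
  then show ?thesis by blast
qed

lemma exp_field_continuous: "continuous_on A (exp_field a1 a2 a3 a4 b1 b2 b3 b4)"
  unfolding exp_field_def Let_def
  by (subst continuous_on_componentwise) 
     (auto simp: Basis_vec_def inner_axis forall_2 intro!: continuous_intros)

definition flip_u :: "real^2 \<Rightarrow> real^2" where "flip_u w = vector [- w $ 1, w $ 2]"
definition flip_v :: "real^2 \<Rightarrow> real^2" where "flip_v w = vector [w $ 1, - w $ 2]"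
definition swap_uv :: "real^2 \<Rightarrow> real^2" where "swap_uv w = vector [w $ 2, w $ 1]"

lemma orthogonal_flips:
  "orthogonal_transformation flip_u" "orthogonal_transformation flip_v"
  "orthogonal_transformation swap_uv"
  by (auto simp: orthogonal_transformation_def flip_u_def flip_v_def swap_uv_def inner_vec_def
      sum_2 vec_eq_iff forall_2 intro!: linearI)

text \<open>Reflections and the exchange of coordinates act on the exponents as follows. The sign pattern
of \<open>J\<close> can thus be normalised: \<open>flip_u\<close> and \<open>flip_v\<close> keep the diagonal of \<open>J\<close> and negate both
off-diagonal entries, and \<open>swap_uv\<close> interchanges the two entries in each of these pairs.\<close>

lemma exp_field_flips:
  "exp_field (- a2) (- a1) (- a3) (- a4) b2 b1 b3 b4 (flip_u w)
     = flip_u (exp_field a1 a2 a3 a4 b1 b2 b3 b4 w)"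
  "exp_field a1 a2 a4 a3 (- b1) (- b2) (- b4) (- b3) (flip_v w)
     = flip_v (exp_field a1 a2 a3 a4 b1 b2 b3 b4 w)"
  "exp_field b3 b4 b1 b2 a3 a4 a1 a2 (swap_uv w)
     = swap_uv (exp_field a1 a2 a3 a4 b1 b2 b3 b4 w)"
  by (auto simp: vec_eq_iff forall_2 exp_field_nth flip_u_def flip_v_def swap_uv_def add.commute)

lemma exp_field_permanent_flips:
  assumes "permanent (exp_field a1 a2 a3 a4 b1 b2 b3 b4)"
  shows "permanent (exp_field (- a2) (- a1) (- a3) (- a4) b2 b1 b3 b4)"
    and "permanent (exp_field a1 a2 a4 a3 (- b1) (- b2) (- b4) (- b3))"
    and "permanent (exp_field b3 b4 b1 b2 a3 a4 a1 a2)"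
  by (rule permanent_conjugate[where F = "exp_field a1 a2 a3 a4 b1 b2 b3 b4"],
      rule orthogonal_flips, rule exp_field_flips, rule assms)+

lemma exp_field_stable_flips:
  assumes "globally_asymptotically_stable (exp_field a1 a2 a3 a4 b1 b2 b3 b4) 0"
  shows "globally_asymptotically_stable (exp_field (- a2) (- a1) (- a3) (- a4) b2 b1 b3 b4) 0"
    and "globally_asymptotically_stable (exp_field b3 b4 b1 b2 a3 a4 a1 a2) 0"
  by (rule globally_asymptotically_stable_conjugate
      [where F = "exp_field a1 a2 a3 a4 b1 b2 b3 b4"],
      rule orthogonal_flips, rule exp_field_flips, rule assms)+

section \<open>Stability when the diagonal dominates\<close>

lemma mult_exp_minus_one_le:
  fixes x y :: real
  assumes "x * y \<le> 0"
  shows "x * (exp y - 1) \<le> x * y * exp (- \<bar>y\<bar>)"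
proof (cases "y \<ge> 0")
  case True
  show ?thesis
  proof (cases "y = 0")
    case False
    then have "x \<le> 0" using assms True by (simp add: mult_le_0_iff)
    moreover have "y * exp (- y) \<le> y * 1" using True by (intro mult_left_mono) auto
    then have "y * exp (- y) \<le> exp y - 1" using exp_ge_add_one_self[of y] by linarith
    ultimately show ?thesis using True mult_left_mono_neg[of _ _ x] by (simp add: mult.assoc)
  qed simp
next
  case False
  then have "x \<ge> 0" using assms by (simp add: mult_le_0_iff)
  have "(1 - y) * exp y \<le> exp (- y) * exp y"
    using exp_ge_add_one_self[of "- y"] by (intro mult_right_mono) auto
  then have "exp y - 1 \<le> y * exp y" by (simp add: exp_minus algebra_simps)
  then show ?thesis using \<open>x \<ge> 0\<close> False mult_left_mono[of _ _ x] by (simp add: mult.assoc)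
qed

text \<open>The hypothesis says that the linearisation damps \<open>u\<close> at rate \<open>k\<close>. Factoring out the exponential
with exponents \<open>a2, b2\<close> shows that the nonlinear field damps \<open>u\<close> as well, at a rate which is
uniform on bounded sets, where a common \<open>D\<close> is available.\<close>

lemma exp_difference_damping:
  fixes u v :: real
  assumes "u * ((a1 - a2) * u + (b1 - b2) * v) \<le> - k * u\<^sup>2" and "k \<ge> 0"
    and "\<bar>a2 * u + b2 * v\<bar> + \<bar>(a1 - a2) * u + (b1 - b2) * v\<bar> \<le> D"
  shows "u * (exp (a1 * u + b1 * v) - exp (a2 * u + b2 * v)) \<le> - k * exp (- D) * u\<^sup>2"
proof -
  define y where "y = (a1 - a2) * u + (b1 - b2) * v"
  define E where "E = a2 * u + b2 * v"
  have uy: "u * y \<le> - (k * u\<^sup>2)" using assms by (simp add: y_def)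
  moreover have "0 \<le> k * u\<^sup>2" using assms by simp
  ultimately have "u * y \<le> 0" by linarith
  then have "u * (exp y - 1) \<le> u * y * exp (- \<bar>y\<bar>)" by (rule mult_exp_minus_one_le)
  also have "\<dots> \<le> - (k * u\<^sup>2) * exp (- \<bar>y\<bar>)" using uy by (intro mult_right_mono) auto
  finally have "exp E * (u * (exp y - 1)) \<le> exp E * (- (k * u\<^sup>2) * exp (- \<bar>y\<bar>))"
    by (intro mult_left_mono) auto
  also have "\<dots> = - (k * u\<^sup>2) * exp (E - \<bar>y\<bar>)" by (simp add: exp_diff exp_minus field_simps)
  also have "\<dots> \<le> - (k * u\<^sup>2) * exp (- D)"
  proof -
    have "exp (- D) \<le> exp (E - \<bar>y\<bar>)" using assms(3) by (auto simp: E_def y_def)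
    then show ?thesis using \<open>0 \<le> k * u\<^sup>2\<close> mult_left_mono by fastforce
  qed
  also have "exp E * (u * (exp y - 1)) = u * (exp (a1 * u + b1 * v) - exp (a2 * u + b2 * v))"
  proof -
    have "exp (a1 * u + b1 * v) = exp E * exp y"
      by (simp add: E_def y_def exp_add[symmetric] algebra_simps)
    then show ?thesis by (simp add: E_def algebra_simps)
  qed
  finally show ?thesis by (simp add: mult_ac)
qed

text \<open>The estimate is only needed for the coordinate that attains the weighted maximum. Squares avoid
a distinction by the sign of the coordinate. The rate \<open>\<rho> = 0\<close> gives monotonicity of the maximum,
and hence boundedness; a rate \<open>\<rho> > 0\<close>, available once solutions are known to be bounded, gives
exponential decay.\<close>

lemma weighted_max_square_decay:
  fixes F :: "real^2 \<Rightarrow> real^2" and w :: "real^2"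
  assumes w: "\<And>i. w $ i > 0" and T: "0 \<le> T" and x: "ode_solution F x {0..T}"
    and damp: "\<And>i t. t \<in> {0..T} \<Longrightarrow> x t $ i \<noteq> 0 \<Longrightarrow>
      (\<And>j. \<bar>x t $ j\<bar> / w $ j \<le> \<bar>x t $ i\<bar> / w $ i) \<Longrightarrow>
      \<rho> * (x t $ i)\<^sup>2 + 2 * (x t $ i * F (x t) $ i) < 0"
    and c: "\<And>i. (x 0 $ i / w $ i)\<^sup>2 \<le> c"
  shows "exp (\<rho> * T) * (x T $ i / w $ i)\<^sup>2 \<le> c"
proof (rule barrier_family[where I = UNIV and c = c and d = "c + 1" and T = T and i = i
        and f = "\<lambda>i t. exp (\<rho> * t) * (x t $ i / w $ i)\<^sup>2"
        and f' = "\<lambda>i t. exp (\<rho> * t) / (w $ i)\<^sup>2 * (\<rho> * (x t $ i)\<^sup>2 + 2 * (x t $ i * F (x t) $ i))"])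
  fix i t assume t: "t \<in> {0..T}"
  show "((\<lambda>t. exp (\<rho> * t) * (x t $ i / w $ i)\<^sup>2) has_real_derivative
      exp (\<rho> * t) / (w $ i)\<^sup>2 * (\<rho> * (x t $ i)\<^sup>2 + 2 * (x t $ i * F (x t) $ i)))
      (at t within {0..T})"
    using w[of i] by (auto intro!: derivative_eq_intros ode_solution_nth_derivative[OF x t]
       simp: field_simps power2_eq_square)
  assume *: "c < exp (\<rho> * t) * (x t $ i / w $ i)\<^sup>2"
    "\<And>j. j \<in> UNIV \<Longrightarrow> exp (\<rho> * t) * (x t $ j / w $ j)\<^sup>2 \<le> exp (\<rho> * t) * (x t $ i / w $ i)\<^sup>2"
  have "0 \<le> c" using c[of i] zero_le_power2 order_trans by blast
  then have "x t $ i \<noteq> 0" using *(1) by auto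
  moreover have "\<bar>x t $ j\<bar> / w $ j \<le> \<bar>x t $ i\<bar> / w $ i" for j
    using *(2)[of j] w[of i] w[of j] by (simp add: abs_le_square_iff[symmetric] abs_divide)
  ultimately show "exp (\<rho> * t) / (w $ i)\<^sup>2 * (\<rho> * (x t $ i)\<^sup>2 + 2 * (x t $ i * F (x t) $ i)) < 0"
    using damp[OF t, of i] w[of i] by (intro mult_pos_neg) auto
qed (use assms in auto)

text \<open>The weights \<open>m = \<bar>s\<bar> + \<bar>q\<bar>\<close> and \<open>n = \<bar>p\<bar> + \<bar>r\<bar>\<close> make the linear damping \<open>\<bar>p\<bar> m - \<bar>q\<bar> n\<close> and
\<open>\<bar>s\<bar> n - \<bar>r\<bar> m\<close> of the two coordinates equal: both are \<open>\<kappa> = p s - \<bar>q r\<bar>\<close>.\<close>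

lemma globally_asymptotically_stable_diagonal_dominant:
  assumes "a1 < a2" "b3 < b4" and dom: "\<bar>(b1 - b2) * (a3 - a4)\<bar> < (a1 - a2) * (b3 - b4)"
  shows "globally_asymptotically_stable (exp_field a1 a2 a3 a4 b1 b2 b3 b4) 0"
proof -
  let ?F = "exp_field a1 a2 a3 a4 b1 b2 b3 b4"
  define m where "m = (b4 - b3) + \<bar>b1 - b2\<bar>"
  define n where "n = (a2 - a1) + \<bar>a3 - a4\<bar>"
  define \<kappa> where "\<kappa> = (a1 - a2) * (b3 - b4) - \<bar>(b1 - b2) * (a3 - a4)\<bar>"
  have mn: "m > 0" "n > 0" "\<kappa> > 0" using assms by (auto simp: m_def n_def \<kappa>_def)
  have \<kappa>: "(a2 - a1) * m - \<bar>b1 - b2\<bar> * n = \<kappa>" "(b4 - b3) * n - \<bar>a3 - a4\<bar> * m = \<kappa>"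
    unfolding m_def n_def \<kappa>_def abs_mult by (simp_all add: algebra_simps)
  define w :: "real^2" where "w = vector [m, n]"
  have w: "w $ 1 = m" "w $ 2 = n" by (auto simp: w_def)
  have wpos: "w $ i > 0" for i using exhaust_2[of i] mn w by auto
  define V where "V z = max ((z $ 1 / m)\<^sup>2) ((z $ 2 / n)\<^sup>2)" for z :: "real^2"
  have Vw: "(z $ i / w $ i)\<^sup>2 \<le> V z" for z i using exhaust_2[of i] by (auto simp: V_def w)
  have Vcont: "continuous_on A V" for A unfolding V_def using mn by (intro continuous_intros) auto
  \<comment> \<open>The damping of the coordinate \<open>u\<close> when it attains the weighted maximum; it is used for both
      coordinates, with the roles of the weights exchanged.\<close>
  have coercive: "u * (p * u + q * v) \<le> - (\<kappa> / m') * u\<^sup>2"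
    if "m' > 0" "n' > 0" "- p * m' - \<bar>q\<bar> * n' = \<kappa>" "\<bar>v\<bar> / n' \<le> \<bar>u\<bar> / m'" for p q u v m' n' :: real
  proof -
    define c where "c = n' / m'"
    have "\<bar>v\<bar> \<le> c * \<bar>u\<bar>" using that by (simp add: c_def field_simps)
    then have "(\<bar>q\<bar> * \<bar>u\<bar>) * \<bar>v\<bar> \<le> (\<bar>q\<bar> * \<bar>u\<bar>) * (c * \<bar>u\<bar>)" by (intro mult_left_mono) auto
    also have "\<dots> = \<bar>q\<bar> * c * (\<bar>u\<bar> * \<bar>u\<bar>)" by (simp only: mult_ac)
    also have "\<bar>u\<bar> * \<bar>u\<bar> = u\<^sup>2" by (simp add: power2_eq_square)
    finally have "q * u * v \<le> \<bar>q\<bar> * c * u\<^sup>2"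
      using abs_ge_self[of "q * u * v"] unfolding abs_mult by linarith
    moreover have "- (\<kappa> / m') = p + \<bar>q\<bar> * c"
      using that(1) unfolding that(3)[symmetric] c_def by (simp add: field_simps)
    moreover have "u * (p * u + q * v) = p * u\<^sup>2 + q * u * v"
      by (simp add: algebra_simps power2_eq_square)
    ultimately show ?thesis by (simp add: distrib_right)
  qed
  define D where "D z = (\<bar>a2 * z $ 1 + b2 * z $ 2\<bar> + \<bar>(a1 - a2) * z $ 1 + (b1 - b2) * z $ 2\<bar>)
      + (\<bar>b4 * z $ 2 + a4 * z $ 1\<bar> + \<bar>(b3 - b4) * z $ 2 + (a3 - a4) * z $ 1\<bar>)" for z :: "real^2"
  have Dcont: "continuous_on A D" for A unfolding D_def by (intro continuous_intros)
  have damping: "z $ i * ?F z $ i \<le> - (\<kappa> / w $ i) * exp (- D') * (z $ i)\<^sup>2"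
    if act: "\<And>j. \<bar>z $ j\<bar> / w $ j \<le> \<bar>z $ i\<bar> / w $ i" and D': "D z \<le> D'" for z i D'
  proof -
    have D12: "\<bar>a2 * z $ 1 + b2 * z $ 2\<bar> + \<bar>(a1 - a2) * z $ 1 + (b1 - b2) * z $ 2\<bar> \<le> D'"
      "\<bar>b4 * z $ 2 + a4 * z $ 1\<bar> + \<bar>(b3 - b4) * z $ 2 + (a3 - a4) * z $ 1\<bar> \<le> D'"
      using D' unfolding D_def by linarith+
    from exhaust_2[of i] show ?thesis
    proof
      assume i: "i = 1"
      have "z $ 1 * (exp (a1 * z $ 1 + b1 * z $ 2) - exp (a2 * z $ 1 + b2 * z $ 2))
          \<le> - (\<kappa> / m) * exp (- D') * (z $ 1)\<^sup>2"
        using mn \<kappa>(1) act[of 2] w i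
        by (intro exp_difference_damping[OF _ _ D12(1)] coercive[of m n]) (simp_all add: algebra_simps)
      then show ?thesis by (simp add: i exp_field_nth w)
    next
      assume i: "i = 2"
      have "z $ 2 * (exp (b3 * z $ 2 + a3 * z $ 1) - exp (b4 * z $ 2 + a4 * z $ 1))
          \<le> - (\<kappa> / n) * exp (- D') * (z $ 2)\<^sup>2"
        using mn \<kappa>(2) act[of 1] w i
        by (intro exp_difference_damping[OF _ _ D12(2)] coercive[of n m]) (simp_all add: algebra_simps)
      then show ?thesis by (simp add: i exp_field_nth w add.commute)
    qed
  qed
  have dec: "V (x T) \<le> V (x 0)" if "0 \<le> T" "ode_solution ?F x {0..T}" for x T
  proof -
    have "exp (0 * T) * (x T $ i / w $ i)\<^sup>2 \<le> V (x 0)" for i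
    proof (rule weighted_max_square_decay[OF wpos that _ Vw])
      fix i t assume "x t $ i \<noteq> 0" and act: "\<And>j. \<bar>x t $ j\<bar> / w $ j \<le> \<bar>x t $ i\<bar> / w $ i"
      then have "0 < \<kappa> / w $ i * exp (- D (x t)) * (x t $ i)\<^sup>2" using mn wpos[of i] by simp
      then show "0 * (x t $ i)\<^sup>2 + 2 * (x t $ i * ?F (x t) $ i) < 0"
        using damping[OF act order_refl] by simp
    qed
    from this[of 1] this[of 2] show ?thesis by (simp add: V_def w)
  qed
  have Vpos: "V z > 0" if "z \<noteq> 0" for z
    using that mn by (auto simp: V_def vec_eq_iff forall_2 less_max_iff_disj)
  have sub: "compact {z. V z \<le> c}" for c
  proof -
    have "norm z \<le> m * sqrt c + n * sqrt c" if "V z \<le> c" for z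
    proof -
      have "\<bar>z $ 1 / m\<bar> \<le> sqrt c" "\<bar>z $ 2 / n\<bar> \<le> sqrt c"
        using that real_sqrt_le_mono[of "(z $ 1 / m)\<^sup>2" c, unfolded real_sqrt_abs]
          real_sqrt_le_mono[of "(z $ 2 / n)\<^sup>2" c, unfolded real_sqrt_abs]
        by (auto simp: V_def)
      then have "\<bar>z $ 1\<bar> \<le> m * sqrt c" "\<bar>z $ 2\<bar> \<le> n * sqrt c"
        using mn by (auto simp: field_simps)
      then show ?thesis using norm_real_2_le[of z] by linarith
    qed
    then have "bounded {z. V z \<le> c}" unfolding bounded_iff by blast
    moreover have "closed {z. V z \<le> c}" by (intro closed_Collect_le Vcont continuous_intros)
    ultimately show ?thesis by (simp add: compact_eq_bounded_closed)
  qed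
  show ?thesis
  proof (rule globally_asymptotically_stable_criterion)
    show "?F 0 = 0" by (simp add: exp_field_eq_0_iff)
    show "\<exists>L. L-lipschitz_on (cball 0 R) ?F" for R by (rule exp_field_lipschitz_on_cball)
    show "lyapunov_stable ?F 0"
    proof (rule lyapunov_stable_if_nonincreasing_along_solutions[OF Vcont _ _ dec])
      show "V 0 = 0" by (simp add: V_def)
      show "V z > 0" if "z \<noteq> 0" for z using that by (rule Vpos)
    qed
    show "bounded (reachable ?F p)" for p
      by (rule bounded_subset[OF compact_imp_bounded[OF sub[of "V p"]]])
        (auto simp: reachable_def intro: dec)
    fix x assume x: "ode_solution ?F x {0..}"
    have xT: "ode_solution ?F x {0..T}" for T by (rule ode_solution_subset[OF x]) auto
    define K where "K = {z. V z \<le> V (x 0)}"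
    have K: "compact K" "\<And>t. 0 \<le> t \<Longrightarrow> x t \<in> K"
      using sub dec xT by (auto simp: K_def)
    have "bounded (D ` K)" by (intro compact_imp_bounded compact_continuous_image Dcont K)
    then obtain D' where D': "\<And>z. z \<in> K \<Longrightarrow> D z \<le> D'"
      using bounded_imp_bdd_above unfolding bdd_above_def by (metis imageI)
    define \<rho> where "\<rho> = min (\<kappa> / m * exp (- D')) (\<kappa> / n * exp (- D'))"
    have \<rho>: "\<rho> > 0" "\<rho> \<le> \<kappa> / w $ i * exp (- D')" for i
      using mn w exhaust_2[of i] by (auto simp: \<rho>_def)
    have "exp (\<rho> * T) * (x T $ i / w $ i)\<^sup>2 \<le> V (x 0)" if T: "0 \<le> T" for i T
    proof (rule weighted_max_square_decay[OF wpos T xT _ Vw])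
      fix i t assume t: "t \<in> {0..T}" and nz: "x t $ i \<noteq> 0"
        and act: "\<And>j. \<bar>x t $ j\<bar> / w $ j \<le> \<bar>x t $ i\<bar> / w $ i"
      have "x t $ i * ?F (x t) $ i \<le> - (\<kappa> / w $ i) * exp (- D') * (x t $ i)\<^sup>2"
        using t by (intro damping act D' K) auto
      also have "\<dots> \<le> - \<rho> * (x t $ i)\<^sup>2"
        using \<rho>(2)[of i] by (intro mult_right_mono) auto
      finally have "x t $ i * ?F (x t) $ i \<le> - (\<rho> * (x t $ i)\<^sup>2)" by simp
      moreover have "0 < \<rho> * (x t $ i)\<^sup>2" using \<rho>(1) nz by simp
      ultimately show "\<rho> * (x t $ i)\<^sup>2 + 2 * (x t $ i * ?F (x t) $ i) < 0" by linarith
    qed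
    note decay = this
    have bd: "V (x t) \<le> V (x 0) * exp (- (\<rho> * t))" if "0 \<le> t" for t
    proof -
      have "(x t $ i / w $ i)\<^sup>2 \<le> V (x 0) * exp (- (\<rho> * t))" for i
        using decay[OF that, of i] pos_le_divide_eq[of "exp (\<rho> * t)" "(x t $ i / w $ i)\<^sup>2" "V (x 0)"]
        by (simp add: exp_minus divide_inverse mult.commute)
      from this[of 1] this[of 2] show ?thesis unfolding V_def[of "x t"] w by simp
    qed
    have "((\<lambda>t. exp (- (\<rho> * t))) \<longlongrightarrow> 0) at_top"
      using \<rho>(1)
      by (intro filterlim_compose[OF exp_at_bot] filterlim_compose[OF filterlim_uminus_at_bot_at_top]
          filterlim_tendsto_pos_mult_at_top[OF tendsto_const] filterlim_ident)
    then have lim: "((\<lambda>t. V (x 0) * exp (- (\<rho> * t))) \<longlongrightarrow> 0) at_top"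
      by (rule tendsto_mult_right_zero)
    have "((\<lambda>t. V (x t)) \<longlongrightarrow> 0) at_top"
    proof (rule tendsto_sandwich[OF _ _ tendsto_const lim])
      show "\<forall>\<^sub>F t in at_top. 0 \<le> V (x t)" by (simp add: V_def le_max_iff_disj)
      show "\<forall>\<^sub>F t in at_top. V (x t) \<le> V (x 0) * exp (- (\<rho> * t))"
        using bd eventually_at_top_linorder by blast
    qed
    then have "((\<lambda>t. id (x t)) \<longlongrightarrow> 0) at_top"
    proof (rule tendsto_zero_on_compact[OF K Vcont _ _, rotated -1])
      show "id z = 0" if "V z = 0" for z using Vpos[of z] that by auto
    qed (auto intro: continuous_on_id)
    then show "(x \<longlongrightarrow> 0) at_top" by simp
  qed
qed

section \<open>A separable Lyapunov function\<close>

text \<open>The antiderivative of \<open>\<lambda>u. exp (c * u)\<close> that vanishes at \<open>0\<close>.\<close>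

definition exp_integral :: "real \<Rightarrow> real \<Rightarrow> real"
  where "exp_integral c u = (if c = 0 then u else (exp (c * u) - 1) / c)"

definition exp_gap :: "real \<Rightarrow> real \<Rightarrow> real \<Rightarrow> real"
  where "exp_gap c d u = exp_integral c u - exp_integral d u"

lemma exp_integral_has_derivative:
  "(exp_integral c has_real_derivative exp (c * u)) (at u within S)"
proof (cases "c = 0")
  case True
  then have "exp_integral c = (\<lambda>u. u)" by (auto simp: exp_integral_def)
  then show ?thesis using True by simp
next
  case False
  then have "exp_integral c = (\<lambda>u. (exp (c * u) - 1) / c)" by (auto simp: exp_integral_def)
  then show ?thesis using False by (auto intro!: derivative_eq_intros)
qed

lemma exp_gap_has_derivative:
  "(exp_gap c d has_real_derivative exp (c * u) - exp (d * u)) (at u within S)"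
  unfolding exp_gap_def by (intro derivative_intros exp_integral_has_derivative)

lemma exp_gap_continuous: "continuous_on A (exp_gap c d)"
  by (rule DERIV_continuous_on[OF exp_gap_has_derivative])

lemma exp_gap_0 [simp]: "exp_gap c d 0 = 0"
  by (simp add: exp_gap_def exp_integral_def)

lemma exp_gap_minus: "exp_gap c d (- u) = exp_gap (- d) (- c) u"
  by (auto simp: exp_gap_def exp_integral_def field_simps)

lemma exp_gap_pos:
  assumes "d < c" "u \<noteq> 0"
  shows "0 < exp_gap c d u"
proof -
  have pos: "0 < exp_gap c d u" if dc: "d < c" and u: "0 < u" for c d u
  proof -
    obtain z where "0 < z" "exp_gap c d u - exp_gap c d 0 = (u - 0) * (exp (c * z) - exp (d * z))"
      using MVT2[OF u exp_gap_has_derivative] by blast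
    then show ?thesis using dc u by simp
  qed
  show ?thesis
  proof (cases "0 < u")
    case False
    then show ?thesis using pos[of "- c" "- d" "- u"] assms exp_gap_minus[of c d "- u"] by simp
  qed (use pos assms in blast)
qed

lemma exp_gap_nonneg: "d < c \<Longrightarrow> 0 \<le> exp_gap c d u"
  using exp_gap_pos[of d c u] by (cases "u = 0") auto

text \<open>For \<open>c \<ge> 0\<close> and \<open>u \<ge> 0\<close> the derivative \<open>exp (c u) - exp (d u)\<close> is at least \<open>1 - exp (- (c - d) u)\<close>:
their difference factors as \<open>(exp (c u) - 1) (1 - exp (- (c - d) u))\<close>. If \<open>c < 0\<close>, the
function is bounded on the right.\<close>

lemma exp_gap_growth_right:
  assumes "d < c" "0 \<le> c" "0 \<le> u"
  shows "u - 1 / (c - d) \<le> exp_gap c d u"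
proof (cases "u = 0")
  case False
  then have "0 < u" using assms by simp
  define r where "r = c - d"
  have r: "0 < r" "d = c - r" using assms by (auto simp: r_def)
  define h where "h u = exp_gap c d u - u - exp (- r * u) / r" for u
  have "(h has_real_derivative (exp (c * u) - 1) * (1 - exp (- r * u))) (at u)" for u
  proof -
    have "(h has_real_derivative exp (c * u) - exp (d * u) - 1 + exp (- r * u)) (at u)"
      unfolding h_def using r(1) by (auto intro!: derivative_eq_intros exp_gap_has_derivative)
    moreover have "exp (c * u) * exp (- r * u) = exp (d * u)"
      by (simp add: r(2) exp_add[symmetric] algebra_simps)
    ultimately show ?thesis by (simp add: algebra_simps)
  qed
  from MVT2[OF \<open>0 < u\<close> this] obtain z where
    "0 < z" "h u - h 0 = (u - 0) * ((exp (c * z) - 1) * (1 - exp (- r * z)))" by blast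
  moreover from this have "0 \<le> (u - 0) * ((exp (c * z) - 1) * (1 - exp (- r * z)))"
    using assms r(1) by (intro mult_nonneg_nonneg) auto
  ultimately have "h 0 \<le> h u" by linarith
  moreover have "0 \<le> exp (- r * u) / r" using r by simp
  moreover have "h 0 = - (1 / r)" by (simp add: h_def)
  ultimately show ?thesis by (simp add: h_def r_def)
qed (use assms in simp)

lemma exp_gap_growth_left:
  assumes "d < c" "d \<le> 0" "u \<le> 0"
  shows "- u - 1 / (c - d) \<le> exp_gap c d u"
  using exp_gap_growth_right[of "- c" "- d" "- u"] exp_gap_minus[of c d "- u"] assms by simp

lemma mult_exp_differences_nonneg:
  fixes x :: real
  assumes "b \<le> a" "d \<le> c"
  shows "0 \<le> (exp (a * x) - exp (b * x)) * (exp (c * x) - exp (d * x))"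
proof (cases "0 \<le> x")
  case True
  then show ?thesis using assms by (intro mult_nonneg_nonneg) (auto intro: mult_right_mono)
next
  case False
  then show ?thesis using assms by (intro mult_nonpos_nonpos) (auto intro: mult_right_mono_neg)
qed

context
  fixes a1 a2 a3 a4 b1 b2 b3 b4 :: real
begin

abbreviation (input) "field \<equiv> exp_field a1 a2 a3 a4 b1 b2 b3 b4"

text \<open>This is the function \<open>V\<close> of the introduction, which is a first integral when \<open>a1 = a2\<close>
and \<open>b3 = b4\<close>.\<close>

definition lyap :: "real^2 \<Rightarrow> real"
  where "lyap z = exp_gap (a3 - a1) (a4 - a1) (z $ 1) + exp_gap (b2 - b3) (b1 - b3) (z $ 2)"

text \<open>The derivative of \<open>lyap\<close> in the direction of the field.\<close>

definition lyap_rate :: "real^2 \<Rightarrow> real"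
  where "lyap_rate z = (exp ((a3 - a1) * z $ 1) - exp ((a4 - a1) * z $ 1)) * field z $ 1
                     + (exp ((b2 - b3) * z $ 2) - exp ((b1 - b3) * z $ 2)) * field z $ 2"

lemma lyap_continuous: "continuous_on A lyap"
  unfolding lyap_def
  by (intro continuous_intros continuous_on_compose2[OF exp_gap_continuous[of UNIV]]) auto

lemma lyap_rate_continuous: "continuous_on A lyap_rate"
  unfolding lyap_rate_def
  by (intro continuous_intros exp_field_continuous)

lemma lyap_derivative_along_solution:
  assumes "ode_solution field x I" "t \<in> I"
  shows "((\<lambda>t. lyap (x t)) has_real_derivative lyap_rate (x t)) (at t within I)"
  unfolding lyap_def lyap_rate_def
  by (intro derivative_intros DERIV_chain2[OF exp_gap_has_derivative]
      ode_solution_nth_derivative[OF assms])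

text \<open>The choice of \<open>a1\<close> and \<open>b3\<close> as reference exponents makes the cross terms
\<open>(A3 - A4) (B1 - B2)\<close> and \<open>(B2 - B1) (A3 - A4)\<close> cancel. In each remaining summand the two
differences of exponentials are functions of the same coordinate, so their product has a
constant sign. The constant \<open>1\<close> is written as \<open>exp (0 * _)\<close> to match
\<open>mult_exp_differences_nonneg\<close>.\<close>

lemma lyap_rate_eq:
  "lyap_rate z = exp (a1 * z $ 1 + b3 * z $ 2) *
     (  (exp ((a3 - a1) * z $ 1) - exp ((a4 - a1) * z $ 1)) * (exp (0 * z $ 1) - exp ((a2 - a1) * z $ 1))
          * exp ((b2 - b3) * z $ 2)
      + (exp ((b2 - b3) * z $ 2) - exp ((b1 - b3) * z $ 2)) * (exp (0 * z $ 2) - exp ((b4 - b3) * z $ 2))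
          * exp ((a4 - a1) * z $ 1))"
proof -
  define u v where "u = z $ 1" and "v = z $ 2"
  define A3 A2 A4 where "A3 = exp ((a3 - a1) * u)" and "A2 = exp ((a2 - a1) * u)"
    and "A4 = exp ((a4 - a1) * u)"
  define B1 B2 B4 where "B1 = exp ((b1 - b3) * v)" and "B2 = exp ((b2 - b3) * v)"
    and "B4 = exp ((b4 - b3) * v)"
  define E where "E = exp (a1 * u + b3 * v)"
  have "exp (a1 * u + b1 * v) = E * B1" "exp (a2 * u + b2 * v) = E * (A2 * B2)"
    "exp (a3 * u + b3 * v) = E * A3" "exp (a4 * u + b4 * v) = E * (A4 * B4)"
    by (simp_all add: E_def A3_def A2_def A4_def B1_def B2_def B4_def exp_add[symmetric] algebra_simps)
  then have F: "field z $ 1 = E * (B1 - A2 * B2)" "field z $ 2 = E * (A3 - A4 * B4)"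
    by (simp_all add: exp_field_nth u_def v_def algebra_simps)
  have "lyap_rate z = (A3 - A4) * (E * (B1 - A2 * B2)) + (B2 - B1) * (E * (A3 - A4 * B4))"
    unfolding lyap_rate_def F by (simp add: A3_def A4_def B1_def B2_def u_def v_def)
  also have "\<dots> = E * ((A3 - A4) * (1 - A2) * B2 + (B2 - B1) * (1 - B4) * A4)"
    by (simp add: algebra_simps)
  finally show ?thesis
    by (simp add: E_def A3_def A2_def A4_def B1_def B2_def B4_def u_def v_def)
qed

lemma lyap_rate_nonneg:
  assumes "b1 \<le> b2" "a4 \<le> a3" "a2 \<le> a1" "b4 \<le> b3"
  shows "0 \<le> lyap_rate z"
  unfolding lyap_rate_eq using assms
  by (intro mult_nonneg_nonneg add_nonneg_nonneg mult_exp_differences_nonneg) auto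

lemma lyap_rate_nonpos_summands:
  assumes "b1 \<le> b2" "a4 \<le> a3" "a1 \<le> a2" "b3 \<le> b4"
  shows "(exp ((a3 - a1) * z $ 1) - exp ((a4 - a1) * z $ 1))
           * (exp (0 * z $ 1) - exp ((a2 - a1) * z $ 1)) \<le> 0"
    and "(exp ((b2 - b3) * z $ 2) - exp ((b1 - b3) * z $ 2))
           * (exp (0 * z $ 2) - exp ((b4 - b3) * z $ 2)) \<le> 0"
proof -
  have "0 \<le> (exp ((a3 - a1) * z $ 1) - exp ((a4 - a1) * z $ 1))
           * (exp ((a2 - a1) * z $ 1) - exp (0 * z $ 1))"
    "0 \<le> (exp ((b2 - b3) * z $ 2) - exp ((b1 - b3) * z $ 2))
           * (exp ((b4 - b3) * z $ 2) - exp (0 * z $ 2))"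
    by (rule mult_exp_differences_nonneg; use assms in simp)+
  then show "(exp ((a3 - a1) * z $ 1) - exp ((a4 - a1) * z $ 1))
           * (exp (0 * z $ 1) - exp ((a2 - a1) * z $ 1)) \<le> 0"
    "(exp ((b2 - b3) * z $ 2) - exp ((b1 - b3) * z $ 2))
           * (exp (0 * z $ 2) - exp ((b4 - b3) * z $ 2)) \<le> 0"
    unfolding right_diff_distrib by linarith+
qed

lemma lyap_rate_nonpos:
  assumes "b1 \<le> b2" "a4 \<le> a3" "a1 \<le> a2" "b3 \<le> b4"
  shows "lyap_rate z \<le> 0"
  unfolding lyap_rate_eq
  by (intro mult_nonneg_nonpos add_nonpos_nonpos mult_nonpos_nonneg
      lyap_rate_nonpos_summands[OF assms] exp_ge_zero)

lemma lyap_rate_eq_0_imp: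
  assumes "b1 < b2" "a4 \<le> a3" "a1 \<le> a2" "b3 < b4" and "lyap_rate z = 0"
  shows "z $ 2 = 0"
proof (rule ccontr)
  assume nz: "z $ 2 \<noteq> 0"
  have le: "b1 \<le> b2" "b3 \<le> b4" using assms by auto
  note s = lyap_rate_nonpos_summands[OF le(1) assms(2,3) le(2), of z]
  have "(exp ((b2 - b3) * z $ 2) - exp ((b1 - b3) * z $ 2))
           * (exp (0 * z $ 2) - exp ((b4 - b3) * z $ 2)) \<noteq> 0"
    using nz assms by simp
  from mult_neg_pos[OF le_neq_trans[OF s(2) this] exp_gt_zero[of "(a4 - a1) * z $ 1"]]
  have "(exp ((b2 - b3) * z $ 2) - exp ((b1 - b3) * z $ 2))
           * (exp (0 * z $ 2) - exp ((b4 - b3) * z $ 2)) * exp ((a4 - a1) * z $ 1) < 0" .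
  moreover have "(exp ((a3 - a1) * z $ 1) - exp ((a4 - a1) * z $ 1))
           * (exp (0 * z $ 1) - exp ((a2 - a1) * z $ 1)) * exp ((b2 - b3) * z $ 2) \<le> 0"
    using s(1) by (rule mult_nonpos_nonneg) simp
  ultimately have "lyap_rate z < 0"
    unfolding lyap_rate_eq by (intro mult_pos_neg exp_gt_zero) linarith
  then show False using assms(5) by simp
qed

lemma lyap_0: "lyap 0 = 0" by (simp add: lyap_def)

lemma lyap_pos:
  assumes "b1 < b2" "a4 < a3" "z \<noteq> 0"
  shows "0 < lyap z"
proof -
  have "z $ 1 \<noteq> 0 \<or> z $ 2 \<noteq> 0" using assms(3) by (auto simp: vec_eq_iff forall_2)
  then show ?thesis
    unfolding lyap_def
    using assms exp_gap_pos[of "a4 - a1" "a3 - a1" "z $ 1"] exp_gap_nonneg[of "a4 - a1" "a3 - a1" "z $ 1"]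
      exp_gap_pos[of "b1 - b3" "b2 - b3" "z $ 2"] exp_gap_nonneg[of "b1 - b3" "b2 - b3" "z $ 2"]
    by (auto intro: add_pos_nonneg add_nonneg_pos)
qed

text \<open>Of the two conditions at least one holds whenever \<open>a4 < a3\<close>; both hold exactly if \<open>a1\<close> lies
between \<open>a4\<close> and \<open>a3\<close>.\<close>

lemma lyap_controls_u:
  assumes "b1 < b2" "a4 < a3"
  shows "a1 \<le> a3 \<Longrightarrow> z $ 1 \<le> max 0 (lyap z + 1 / (a3 - a4))"
    and "a4 \<le> a1 \<Longrightarrow> - z $ 1 \<le> max 0 (lyap z + 1 / (a3 - a4))"
  using exp_gap_growth_right[of "a4 - a1" "a3 - a1" "z $ 1"]
    exp_gap_growth_left[of "a4 - a1" "a3 - a1" "z $ 1"]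
    exp_gap_nonneg[of "b1 - b3" "b2 - b3" "z $ 2"] assms
  unfolding lyap_def by (cases "0 \<le> z $ 1"; simp)+

end

section \<open>Global stability for off-diagonal entries of opposite sign\<close>

lemma reachable_upper_bound:
  fixes F :: "real^2 \<Rightarrow> real^2"
  assumes "\<And>z. z \<in> reachable F p \<Longrightarrow> C < z $ i \<Longrightarrow> F z $ i < 0" and z: "z \<in> reachable F p"
  shows "z $ i \<le> max (p $ i) C"
proof -
  obtain x T where x: "0 \<le> T" "ode_solution F x {0..T}" "x 0 = p" "z = x T"
    using z by (auto simp: reachable_def)
  have "x T $ i \<le> max (x 0 $ i) C"
  proof (rule barrier[OF ode_solution_nth_derivative[OF x(2)]])
    fix t assume "t \<in> {0..T}" "C < x t $ i"
    then show "F (x t) $ i < 0"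
      using reachableI[OF x(2), of t] x(3) assms(1) by auto
  qed (use x in auto)
  then show ?thesis using x by simp
qed

lemma reachable_lower_bound:
  fixes F :: "real^2 \<Rightarrow> real^2"
  assumes "\<And>z. z \<in> reachable F p \<Longrightarrow> z $ i < C \<Longrightarrow> 0 < F z $ i" and z: "z \<in> reachable F p"
  shows "min (p $ i) C \<le> z $ i"
proof -
  obtain x T where x: "0 \<le> T" "ode_solution F x {0..T}" "x 0 = p" "z = x T"
    using z by (auto simp: reachable_def)
  have "- x T $ i \<le> max (- x 0 $ i) (- C)"
  proof (rule barrier[where f' = "\<lambda>t. - F (x t) $ i"])
    fix t assume t: "t \<in> {0..T}"
    show "((\<lambda>t. - x t $ i) has_real_derivative - F (x t) $ i) (at t within {0..T})"
      using ode_solution_nth_derivative[OF x(2) t] by (auto intro!: derivative_intros)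
    assume "- C < - x t $ i"
    then show "- F (x t) $ i < 0"
      using reachableI[OF x(2), of t] x(3) assms(1) t by auto
  qed (use x in auto)
  then show ?thesis using x by auto
qed

text \<open>Under these signs solutions turn counterclockwise, and the chain of bounds follows the turn:
\<open>u \<le> c\<close> bounds \<open>v\<close> above, because \<open>v\<close> decreases above the line \<open>r u + s v = 0\<close>; this bounds \<open>u\<close>
below, because \<open>u\<close> increases to the left of the line \<open>p u + q v = 0\<close>; this bounds \<open>v\<close> below, and
that bounds \<open>u\<close> above. The chain can start at either of the two bounds on \<open>u\<close>, which \<open>\<sigma>\<close>
selects. The steps from \<open>v\<close> to \<open>u\<close> need \<open>p < 0\<close>; without it the second bound on \<open>u\<close> has to be
supplied.\<close>

lemma bounded_reachable_spiral:
  fixes a1 a2 a3 a4 b1 b2 b3 b4 :: real and p :: "real^2"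
  defines "S \<equiv> reachable (exp_field a1 a2 a3 a4 b1 b2 b3 b4) p"
  assumes q: "b1 < b2" and r: "a4 < a3" and s: "b3 < b4"
    and bdu: "\<And>z. z \<in> S \<Longrightarrow> \<sigma> * z $ 1 \<le> C" and \<sigma>: "\<sigma> = 1 \<or> \<sigma> = -1"
    and other: "a1 < a2 \<or> (\<forall>z\<in>S. - \<sigma> * z $ 1 \<le> C)"
  shows "bounded S"
proof -
  let ?F = "exp_field a1 a2 a3 a4 b1 b2 b3 b4"
  have v_hi: "\<exists>D. \<forall>z\<in>S. z $ 2 \<le> D" if "\<forall>z\<in>S. z $ 1 \<le> c" for c
  proof -
    have "z $ 2 \<le> max (p $ 2) ((a3 - a4) * c / (b4 - b3))" if z: "z \<in> S" for z
    proof (rule reachable_upper_bound[OF _ z[unfolded S_def]])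
      fix y assume "y \<in> reachable ?F p" and y: "(a3 - a4) * c / (b4 - b3) < y $ 2"
      then have "(a3 - a4) * y $ 1 \<le> (a3 - a4) * c"
        using r \<open>\<forall>z\<in>S. z $ 1 \<le> c\<close> by (auto simp: S_def)
      moreover have "(a3 - a4) * c < (b4 - b3) * y $ 2" using y s by (simp add: field_simps)
      ultimately show "?F y $ 2 < 0" by (simp add: exp_field_sign algebra_simps)
    qed
    then show ?thesis by blast
  qed
  have v_lo: "\<exists>D. \<forall>z\<in>S. D \<le> z $ 2" if "\<forall>z\<in>S. c \<le> z $ 1" for c
  proof -
    have "min (p $ 2) ((a3 - a4) * c / (b4 - b3)) \<le> z $ 2" if z: "z \<in> S" for z
    proof (rule reachable_lower_bound[OF _ z[unfolded S_def]])
      fix y assume "y \<in> reachable ?F p" and y: "y $ 2 < (a3 - a4) * c / (b4 - b3)"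
      then have "(a3 - a4) * c \<le> (a3 - a4) * y $ 1"
        using r \<open>\<forall>z\<in>S. c \<le> z $ 1\<close> by (auto simp: S_def)
      moreover have "(b4 - b3) * y $ 2 < (a3 - a4) * c" using y s by (simp add: field_simps)
      ultimately show "0 < ?F y $ 2" by (simp add: exp_field_sign algebra_simps)
    qed
    then show ?thesis by blast
  qed
  have u_lo: "\<exists>D. \<forall>z\<in>S. D \<le> z $ 1" if p: "a1 < a2" and "\<forall>z\<in>S. z $ 2 \<le> c" for c
  proof -
    have "min (p $ 1) (- ((b2 - b1) * c / (a2 - a1))) \<le> z $ 1" if z: "z \<in> S" for z
    proof (rule reachable_lower_bound[OF _ z[unfolded S_def]])
      fix y assume "y \<in> reachable ?F p" and y: "y $ 1 < - ((b2 - b1) * c / (a2 - a1))"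
      then have "(b2 - b1) * y $ 2 \<le> (b2 - b1) * c"
        using q \<open>\<forall>z\<in>S. z $ 2 \<le> c\<close> by (auto simp: S_def)
      moreover have "(b2 - b1) * c < - (a2 - a1) * y $ 1" using y p by (simp add: field_simps)
      ultimately show "0 < ?F y $ 1" by (simp add: exp_field_sign algebra_simps)
    qed
    then show ?thesis by blast
  qed
  have u_hi: "\<exists>D. \<forall>z\<in>S. z $ 1 \<le> D" if p: "a1 < a2" and "\<forall>z\<in>S. c \<le> z $ 2" for c
  proof -
    have "z $ 1 \<le> max (p $ 1) (- ((b2 - b1) * c / (a2 - a1)))" if z: "z \<in> S" for z
    proof (rule reachable_upper_bound[OF _ z[unfolded S_def]])
      fix y assume "y \<in> reachable ?F p" and y: "- ((b2 - b1) * c / (a2 - a1)) < y $ 1"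
      then have "(b2 - b1) * c \<le> (b2 - b1) * y $ 2"
        using q \<open>\<forall>z\<in>S. c \<le> z $ 2\<close> by (auto simp: S_def)
      moreover have "- (a2 - a1) * y $ 1 < (b2 - b1) * c" using y p by (simp add: field_simps)
      ultimately show "?F y $ 1 < 0" by (simp add: exp_field_sign algebra_simps)
    qed
    then show ?thesis by blast
  qed
  have "(\<forall>z\<in>S. z $ 1 \<le> C) \<or> (\<forall>z\<in>S. - C \<le> z $ 1)"
    using \<sigma> bdu by force
  moreover have "(\<forall>z\<in>S. z $ 1 \<le> C) \<and> (\<forall>z\<in>S. - C \<le> z $ 1)" if "\<not> a1 < a2"
    using \<sigma> bdu other that by force
  ultimately obtain c d e f where *: "\<forall>z\<in>S. z $ 1 \<le> c" "\<forall>z\<in>S. d \<le> z $ 1"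
    "\<forall>z\<in>S. z $ 2 \<le> e" "\<forall>z\<in>S. f \<le> z $ 2"
    using u_lo u_hi v_hi v_lo by metis
  have "norm z \<le> max \<bar>c\<bar> \<bar>d\<bar> + max \<bar>e\<bar> \<bar>f\<bar>" if "z \<in> S" for z
    using norm_real_2_le[of z] *[rule_format, OF that] by linarith
  then show ?thesis unfolding bounded_iff by blast
qed

text \<open>The derivative of \<open>lyap\<close> may vanish on the whole line \<open>v = 0\<close>, so Barbalat's lemma is used twice:
applied to \<open>lyap\<close> it gives \<open>v \<rightarrow> 0\<close>, and applied to \<open>v\<close> it gives \<open>v' \<rightarrow> 0\<close>. Only at the
origin do \<open>v\<close> and \<open>v'\<close> vanish together.\<close>

lemma globally_asymptotically_stable_spiral:
  assumes q: "b1 < b2" and r: "a4 < a3" and s: "b3 < b4" and p: "a1 \<le> a2"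
    and B: "a1 = a2 \<Longrightarrow> a4 \<le> a1 \<and> a1 \<le> a3"
  shows "globally_asymptotically_stable (exp_field a1 a2 a3 a4 b1 b2 b3 b4) 0"
proof -
  let ?F = "exp_field a1 a2 a3 a4 b1 b2 b3 b4"
  let ?V = "lyap a1 a3 a4 b1 b2 b3" and ?W = "lyap_rate a1 a2 a3 a4 b1 b2 b3 b4"
  have Wnp: "?W z \<le> 0" for z using q r s p by (intro lyap_rate_nonpos) auto
  have dec: "?V (x T) \<le> ?V (x 0)" if "0 \<le> T" "ode_solution ?F x {0..T}" for x T
    by (rule derivative_nonpos_nonincreasing
        [OF lyap_derivative_along_solution[OF that(2)] Wnp]) (use that in auto)
  have bounded: "bounded (reachable ?F p)" for p
  proof -
    define C where "C = max 0 (?V p + 1 / (a3 - a4))"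
    have VC: "max 0 (?V z + 1 / (a3 - a4)) \<le> C" if "z \<in> reachable ?F p" for z
      using that dec by (force simp: reachable_def C_def)
    have hi: "z $ 1 \<le> C" if "z \<in> reachable ?F p" "a1 \<le> a3" for z
      using lyap_controls_u(1)[OF q r that(2), of z b3] VC[OF that(1)] by linarith
    have lo: "- z $ 1 \<le> C" if "z \<in> reachable ?F p" "a4 \<le> a1" for z
      using lyap_controls_u(2)[OF q r that(2), of z b3] VC[OF that(1)] by linarith
    show ?thesis
    proof (cases "a1 \<le> a3")
      case True
      have "\<forall>z\<in>reachable ?F p. - 1 * z $ 1 \<le> C" if "\<not> a1 < a2"
        using lo B p that by simp
      then show ?thesis
        using hi[OF _ True]
        by (intro bounded_reachable_spiral[OF q r s, where \<sigma> = 1 and C = C]) auto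
    next
      case False
      then have "a1 < a2" "a4 \<le> a1" using B p r by (auto simp: less_le)
      then show ?thesis
        using lo by (intro bounded_reachable_spiral[OF q r s, where \<sigma> = "-1" and C = C]) auto
    qed
  qed
  show ?thesis
  proof (rule globally_asymptotically_stable_criterion[OF _ exp_field_lipschitz_on_cball _ bounded])
    show "?F 0 = 0" by (simp add: exp_field_eq_0_iff)
    show "lyapunov_stable ?F 0"
      by (rule lyapunov_stable_if_nonincreasing_along_solutions
          [OF lyap_continuous lyap_0 lyap_pos[OF q r] dec])
    fix x assume x: "ode_solution ?F x {0..}"
    obtain R where R: "\<And>z. z \<in> reachable ?F (x 0) \<Longrightarrow> norm z \<le> R"
      using bounded bounded_iff by metis
    define K where "K = cball (0::real^2) R"
    have K: "compact K" "\<And>t. 0 \<le> t \<Longrightarrow> x t \<in> K"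
      using R reachableI[OF x] by (auto simp: K_def)
    have "?V (x t) \<le> ?V (x s)" if "0 \<le> s" "s \<le> t" for s t
      using dec[of "t - s" "\<lambda>r. x (r + s)"] ode_solution_subset[OF ode_solution_shift[OF x that(1)]] that
      by auto
    moreover have "0 \<le> ?V z" for z
      using lyap_pos[OF q r, of z] lyap_0 by (cases "z = 0") (auto simp: less_imp_le)
    ultimately obtain l where "((\<lambda>t. ?V (x t)) \<longlongrightarrow> l) at_top"
      using nonincreasing_bounded_below_convergent[of "\<lambda>t. ?V (x t)" 0] by blast
    then have W: "((\<lambda>t. ?W (x t)) \<longlongrightarrow> 0) at_top"
      by (intro barbalat[OF lyap_derivative_along_solution[OF x]]
          bounded_solution_uniformly_continuous[OF x K] exp_field_continuous lyap_rate_continuous) auto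
    have v: "((\<lambda>t. x t $ 2) \<longlongrightarrow> 0) at_top"
      by (rule tendsto_zero_on_compact[OF K lyap_rate_continuous _ _ W])
         (auto intro!: continuous_intros lyap_rate_eq_0_imp[OF q less_imp_le[OF r] p s])
    then have v': "((\<lambda>t. ?F (x t) $ 2) \<longlongrightarrow> 0) at_top"
      by (intro barbalat[OF ode_solution_nth_derivative[OF x]]
          bounded_solution_uniformly_continuous[OF x K] exp_field_continuous continuous_intros) auto
    have "((\<lambda>t. \<bar>x t $ 2\<bar> + \<bar>?F (x t) $ 2\<bar>) \<longlongrightarrow> 0) at_top"
      using tendsto_add[OF tendsto_rabs_zero[OF v] tendsto_rabs_zero[OF v']] by simp
    then have "((\<lambda>t. id (x t)) \<longlongrightarrow> 0) at_top"
    proof (rule tendsto_zero_on_compact[OF K, rotated -1])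
      fix z assume "\<bar>z $ 2\<bar> + \<bar>?F z $ 2\<bar> = 0"
      then have "z $ 2 = 0" "\<not> ?F z $ 2 < 0" "\<not> 0 < ?F z $ 2" by auto
      then have "z $ 1 = 0" using r by (auto simp: exp_field_sign mult_less_0_iff zero_less_mult_iff)
      with \<open>z $ 2 = 0\<close> show "id z = 0" by (auto simp: vec_eq_iff forall_2)
    qed (auto intro!: continuous_intros exp_field_continuous)
    then show "(x \<longlongrightarrow> 0) at_top" by simp
  qed
qed

lemma globally_asymptotically_stable_opposite_signs:
  assumes qr: "(b1 - b2) * (a3 - a4) < 0" and s: "b3 < b4" and p: "a1 \<le> a2"
    and B: "a1 = a2 \<Longrightarrow> min a3 a4 \<le> a1 \<and> a1 \<le> max a3 a4"
  shows "globally_asymptotically_stable (exp_field a1 a2 a3 a4 b1 b2 b3 b4) 0"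
proof (cases "b1 < b2")
  case True
  then have "a4 < a3" using qr by (auto simp: mult_less_0_iff)
  then show ?thesis using True s p B by (intro globally_asymptotically_stable_spiral) auto
next
  case False
  then have "b2 < b1" "a3 < a4" using qr by (auto simp: mult_less_0_iff)
  then have "globally_asymptotically_stable (exp_field (- a2) (- a1) (- a3) (- a4) b2 b1 b3 b4) 0"
    using s p B by (intro globally_asymptotically_stable_spiral) auto
  from exp_field_stable_flips(1)[OF this] show ?thesis by simp
qed

section \<open>Obstructions to permanence\<close>

lemma ode_solution_equilibrium: "F z = 0 \<Longrightarrow> ode_solution F (\<lambda>_. z) I"
  by (simp add: ode_solution_def)

lemma not_permanent_singular:
  assumes det: "(a1 - a2) * (b3 - b4) = (b1 - b2) * (a3 - a4)"
  shows "\<not> permanent (exp_field a1 a2 a3 a4 b1 b2 b3 b4)"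
proof
  let ?F = "exp_field a1 a2 a3 a4 b1 b2 b3 b4"
  assume "permanent ?F"
  then obtain C :: real where C:
    "\<And>x c. ode_solution ?F x {0..} \<Longrightarrow> (\<And>t. 0 \<le> t \<Longrightarrow> c \<le> norm (x t)) \<Longrightarrow> c \<le> C"
    using permanent_bounds_persistent_levels[of ?F norm] by (metis continuous_on_norm_id)
  obtain w :: "real^2" where w: "w \<noteq> 0" "(a1 - a2) * w $ 1 + (b1 - b2) * w $ 2 = 0"
    "(a3 - a4) * w $ 1 + (b3 - b4) * w $ 2 = 0"
  proof -
    consider "a1 - a2 \<noteq> 0 \<or> b1 - b2 \<noteq> 0" | "a1 - a2 = 0" "b1 - b2 = 0" "a3 - a4 \<noteq> 0 \<or> b3 - b4 \<noteq> 0"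
      | "a1 - a2 = 0" "b1 - b2 = 0" "a3 - a4 = 0" "b3 - b4 = 0" by blast
    then show thesis
    proof cases
      case 1
      then show ?thesis using det
        by (intro that[of "vector [b1 - b2, - (a1 - a2)]"]) (auto simp: vec_eq_iff forall_2 algebra_simps)
    next
      case 2
      then show ?thesis
        by (intro that[of "vector [b3 - b4, - (a3 - a4)]"]) (auto simp: vec_eq_iff forall_2 algebra_simps)
    next
      case 3
      then show ?thesis
        by (intro that[of "vector [1, 0]"]) (auto simp: vec_eq_iff forall_2)
    qed
  qed
  define c where "c = (\<bar>C\<bar> + 1) / norm w"
  define z where "z = c *\<^sub>R w"
  have "p * z $ 1 + q * z $ 2 = c * (p * w $ 1 + q * w $ 2)" for p q
    by (simp add: z_def algebra_simps)
  then have "?F z = 0" unfolding exp_field_eq_0_iff using w(2,3) by simp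
  moreover have "norm z = \<bar>C\<bar> + 1" using w(1) by (simp add: z_def c_def)
  ultimately have "\<bar>C\<bar> + 1 \<le> C"
    using C[OF ode_solution_equilibrium, of z "\<bar>C\<bar> + 1"] by simp
  then show False by simp
qed

text \<open>Here \<open>lyap\<close> is nondecreasing along solutions, and it is unbounded because it grows in at least
one of the directions \<open>u \<rightarrow> \<plusminus>\<infinity>\<close>.\<close>

lemma not_permanent_lyap_nondecreasing:
  assumes q: "b1 < b2" and r: "a4 < a3" and p: "a2 \<le> a1" and s: "b4 \<le> b3"
  shows "\<not> permanent (exp_field a1 a2 a3 a4 b1 b2 b3 b4)"
proof
  let ?F = "exp_field a1 a2 a3 a4 b1 b2 b3 b4"
  let ?V = "lyap a1 a3 a4 b1 b2 b3"
  assume perm: "permanent ?F"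
  then obtain C :: real where C:
    "\<And>x c. ode_solution ?F x {0..} \<Longrightarrow> (\<And>t. 0 \<le> t \<Longrightarrow> c \<le> ?V (x t)) \<Longrightarrow> c \<le> C"
    using permanent_bounds_persistent_levels[OF perm lyap_continuous] by blast
  define u where "u = \<bar>C\<bar> + 1 + 1 / (a3 - a4)"
  have u: "0 \<le> u" "C < u - 1 / (a3 - a4)" using r by (auto simp: u_def)
  obtain z :: "real^2" where z: "C < ?V z"
  proof (cases "a1 \<le> a3")
    case True
    then have "C < ?V (vector [u, 0])"
      using exp_gap_growth_right[of "a4 - a1" "a3 - a1" u] u r by (simp add: lyap_def)
    then show ?thesis by (rule that)
  next
    case False
    then have "C < ?V (vector [- u, 0])"
      using exp_gap_growth_left[of "a4 - a1" "a3 - a1" "- u"] u r by (simp add: lyap_def)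
    then show ?thesis by (rule that)
  qed
  obtain x where x: "ode_solution ?F x {0..}" "x 0 = z" using permanent_global_solution[OF perm] .
  have "?V z \<le> ?V (x t)" if t: "0 \<le> t" for t
  proof -
    have "- ?V (x t) \<le> - ?V (x 0)"
    proof (rule derivative_nonpos_nonincreasing)
      fix s assume s': "s \<in> {0..t}"
      have "ode_solution ?F x {0..t}" by (rule ode_solution_subset[OF x(1)]) auto
      from lyap_derivative_along_solution[OF this s']
      show "((\<lambda>t. - ?V (x t)) has_real_derivative - lyap_rate a1 a2 a3 a4 b1 b2 b3 b4 (x s)) (at s within {0..t})"
        by (rule DERIV_minus)
      show "- lyap_rate a1 a2 a3 a4 b1 b2 b3 b4 (x s) \<le> 0"
        using lyap_rate_nonneg[of b1 b2 a4 a3 a2 a1 b4 b3 "x s"] assms by simp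
    qed (use t in auto)
    then show ?thesis using x by simp
  qed
  then have "?V z \<le> C" using C[OF x(1)] by blast
  then show False using z by simp
qed

text \<open>The quadrants \<open>{u \<ge> k m, v \<ge> k n}\<close> with \<open>k > 0\<close> are forward invariant: on an edge, one coordinate
is as in \<open>k (m, n)\<close>, where both components of the field are positive, and enlarging the other
coordinate only helps since \<open>q, r \<ge> 0\<close>.\<close>

lemma not_permanent_expanding_quadrant:
  assumes q: "b2 \<le> b1" and r: "a4 \<le> a3" and mn: "0 < m" "0 < n"
    and exp: "0 < (a1 - a2) * m + (b1 - b2) * n" "0 < (a3 - a4) * m + (b3 - b4) * n"
  shows "\<not> permanent (exp_field a1 a2 a3 a4 b1 b2 b3 b4)"
proof
  let ?F = "exp_field a1 a2 a3 a4 b1 b2 b3 b4"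
  let ?V = "\<lambda>z::real^2. min (z $ 1 / m) (z $ 2 / n)"
  assume perm: "permanent ?F"
  have "continuous_on UNIV ?V" using mn by (intro continuous_intros) auto
  then obtain C :: real where C:
    "\<And>x c. ode_solution ?F x {0..} \<Longrightarrow> (\<And>t. 0 \<le> t \<Longrightarrow> c \<le> ?V (x t)) \<Longrightarrow> c \<le> C"
    using permanent_bounds_persistent_levels[OF perm] by blast
  define k where "k = \<bar>C\<bar> + 1"
  have k: "0 < k" "C < k" by (auto simp: k_def)
  define w :: "real^2" where "w = vector [m, n]"
  have w: "w $ 1 = m" "w $ 2 = n" by (auto simp: w_def)
  have wpos: "0 < w $ i" for i using exhaust_2[of i] mn w by auto
  obtain x where x: "ode_solution ?F x {0..}" "x 0 = k *\<^sub>R w" using permanent_global_solution[OF perm] .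
  have "- (x t $ i / w $ i) \<le> - k" if t: "0 \<le> t" for t i
  proof (rule barrier_family[where I = UNIV and d = 0 and T = t and f = "\<lambda>i t. - (x t $ i / w $ i)"
          and f' = "\<lambda>i t. - (?F (x t) $ i / w $ i)"])
    have xt: "ode_solution ?F x {0..t}" by (rule ode_solution_subset[OF x(1)]) auto
    fix i s assume s: "s \<in> {0..t}"
    show "((\<lambda>t. - (x t $ i / w $ i)) has_real_derivative - (?F (x s) $ i / w $ i)) (at s within {0..t})"
      by (intro DERIV_minus DERIV_cdivide ode_solution_nth_derivative[OF xt s])
    define h where "h = x s $ i / w $ i"
    assume "- (x s $ i / w $ i) < 0"
      and "\<And>j. j \<in> UNIV \<Longrightarrow> - (x s $ j / w $ j) \<le> - (x s $ i / w $ i)"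
    then have h': "0 < h" "h \<le> x s $ j / w $ j" for j by (simp_all add: h_def)
    have h: "0 < h" "h * w $ j \<le> x s $ j" for j
      using wpos[of j] h'(1) h'(2)[of j] pos_le_divide_eq[of "w $ j" h "x s $ j"] by auto
    have hi: "x s $ i = h * w $ i" using wpos[of i] by (simp add: h_def)
    have "0 < ?F (x s) $ i"
      using exhaust_2[of i]
    proof
      assume i: "i = 1"
      have "0 < h * ((a1 - a2) * m + (b1 - b2) * n)" using h(1) exp by simp
      also have "\<dots> = (a1 - a2) * x s $ 1 + (b1 - b2) * (h * n)"
        using hi i w by (simp add: algebra_simps)
      also have "\<dots> \<le> (a1 - a2) * x s $ 1 + (b1 - b2) * x s $ 2"
        using h(2)[of 2] w q by (intro add_left_mono mult_left_mono) auto
      finally show ?thesis unfolding i exp_field_sign .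
    next
      assume i: "i = 2"
      have "0 < h * ((a3 - a4) * m + (b3 - b4) * n)" using h(1) exp by simp
      also have "\<dots> = (a3 - a4) * (h * m) + (b3 - b4) * x s $ 2"
        using hi i w by (simp add: algebra_simps)
      also have "\<dots> \<le> (a3 - a4) * x s $ 1 + (b3 - b4) * x s $ 2"
        using h(2)[of 1] w r by (intro add_right_mono mult_left_mono) auto
      finally show ?thesis unfolding i exp_field_sign .
    qed
    then show "- (?F (x s) $ i / w $ i) < 0" using wpos[of i] by simp
  next
    show "- (x 0 $ i / w $ i) \<le> - k" for i using x(2) wpos[of i] by simp
  qed (use k t in auto)
  from this[of _ 1] this[of _ 2] have "k \<le> ?V (x t)" if "0 \<le> t" for t
    using that by (simp add: w)
  then have "k \<le> C" using C[OF x(1)] by blast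
  then show False using k by simp
qed

text \<open>Divide the field by \<open>exp (a u)\<close>. In the strip \<open>-3 \<le> v \<le> -1/2\<close> the first component is then at least
some \<open>\<mu> > 0\<close>, whereas the second is at most a constant times \<open>exp (- \<delta> u)\<close> with \<open>\<delta> = a - a3 > 0\<close>.
So the total rise of \<open>v\<close> while \<open>u\<close> runs from \<open>u0\<close> to infinity is small if \<open>u0\<close> is large, and
\<open>v\<close> stays negative: \<open>v + D exp (- \<delta> u)\<close> is a decreasing quantity for the constant \<open>D\<close> below.
The solution from \<open>(u0, -2)\<close> therefore stays in the region given by \<open>u \<ge> u0\<close>, \<open>v \<ge> -2\<close> and
\<open>v + 1 + D exp (- \<delta> u) \<le> 0\<close>. The strip is wider than \<open>-2 \<le> v \<le> -1\<close> to leave room for the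
levels up to \<open>1/2\<close> at which the barrier argument inspects the field.\<close>

lemma not_permanent_escape_strip:
  assumes q: "b1 < b2" and r: "a4 < a3" and s: "b3 < b4" and a: "a3 < a"
  shows "\<not> permanent (exp_field a a a3 a4 b1 b2 b3 b4)"
proof
  let ?F = "exp_field a a a3 a4 b1 b2 b3 b4"
  assume perm: "permanent ?F"
  have "continuous_on UNIV (\<lambda>z::real^2. z $ 1)" by (intro continuous_intros)
  then obtain C :: real where C:
    "\<And>x c. ode_solution ?F x {0..} \<Longrightarrow> (\<And>t. 0 \<le> t \<Longrightarrow> c \<le> x t $ 1) \<Longrightarrow> c \<le> C"
    using permanent_bounds_persistent_levels[OF perm] by blast
  define \<delta> where "\<delta> = a - a3"
  define \<mu> where "\<mu> = exp (- (3 * \<bar>b2\<bar>)) * (exp ((b2 - b1) / 2) - 1)"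
  define D where "D = exp (3 * \<bar>b3\<bar>) / (\<delta> * \<mu>)"
  have pos: "0 < \<delta>" "0 < \<mu>" "0 < D" using a q by (auto simp: \<delta>_def \<mu>_def D_def)
  \<comment> \<open>Large enough for \<open>u\<close> to be positive at all levels below \<open>1/2\<close>, for a contradiction with \<open>C\<close>,
      and for \<open>D * exp (- (\<delta> * u0)) \<le> 1\<close>.\<close>
  define u0 where "u0 = max (max 1 (C + 1)) (ln D / \<delta>)"
  have u0: "1 \<le> u0" "C < u0" by (auto simp: u0_def)
  have D_u0: "D * exp (- (\<delta> * u0)) \<le> 1"
  proof -
    have "ln D \<le> \<delta> * u0"
    proof -
      have "ln D / \<delta> \<le> u0" by (simp add: u0_def)
      then show ?thesis using pos(1) by (simp add: field_simps)
    qed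
    then have "D \<le> exp (\<delta> * u0)" using pos(3) by (metis exp_le_cancel_iff exp_ln)
    then show ?thesis by (simp add: exp_minus field_simps)
  qed
  have strip: "\<mu> \<le> exp (b1 * v) - exp (b2 * v)" "exp (b3 * v) \<le> exp (3 * \<bar>b3\<bar>)"
    if v: "- 3 \<le> v" "v \<le> - 1 / 2" for v
  proof -
    have abs_le: "\<bar>b * v\<bar> \<le> 3 * \<bar>b\<bar>" for b
      using v mult_left_mono[of "\<bar>v\<bar>" 3 "\<bar>b\<bar>"] by (simp add: abs_mult abs_le_iff mult.commute)
    have "exp (- (3 * \<bar>b2\<bar>)) \<le> exp (b2 * v)" using abs_le[of b2] by auto
    moreover have "(b2 - b1) * (1 / 2) \<le> (b2 - b1) * (- v)" using v q by (intro mult_left_mono) auto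
    then have "exp ((b2 - b1) / 2) - 1 \<le> exp (b1 * v - b2 * v) - 1" by (simp add: algebra_simps)
    ultimately have "\<mu> \<le> exp (b2 * v) * (exp (b1 * v - b2 * v) - 1)"
      unfolding \<mu>_def using q by (intro mult_mono) auto
    also have "\<dots> = exp (b1 * v) - exp (b2 * v)"
      by (simp add: right_diff_distrib exp_add[symmetric])
    finally show "\<mu> \<le> exp (b1 * v) - exp (b2 * v)" .
    show "exp (b3 * v) \<le> exp (3 * \<bar>b3\<bar>)" using abs_le[of b3] by auto
  qed
  obtain x where x: "ode_solution ?F x {0..}" "x 0 = vector [u0, - 2]"
    using permanent_global_solution[OF perm] .
  have x0: "x 0 $ 1 = u0" "x 0 $ 2 = - 2" by (auto simp: x(2))
  define f where "f i t = [u0 - x t $ 1, - 2 - x t $ 2, x t $ 2 + 1 + D * exp (- (\<delta> * x t $ 1))] ! i"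
    for i t
  define f' where "f' i t = [- ?F (x t) $ 1, - ?F (x t) $ 2,
      ?F (x t) $ 2 - D * \<delta> * exp (- (\<delta> * x t $ 1)) * ?F (x t) $ 1] ! i" for i t
  have "f 0 t \<le> 0" if t: "0 \<le> t" for t
  proof (rule barrier_family[where I = "{0, 1, 2}" and c = 0 and d = "1/2" and T = t and f = f and f' = f'])
    have xt: "ode_solution ?F x {0..t}" by (rule ode_solution_subset[OF x(1)]) auto
    fix i s assume i: "i \<in> {0, 1, 2::nat}" and s': "s \<in> {0..t}"
    note d = ode_solution_nth_derivative[OF xt s']
    show "(f i has_real_derivative f' i s) (at s within {0..t})"
      using i unfolding f_def f'_def
      by (auto intro!: derivative_eq_intros d)
    assume *: "0 < f i s" "f i s < 1 / 2" and max: "\<And>j. j \<in> {0, 1, 2} \<Longrightarrow> f j s \<le> f i s"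
    define u v where "u = x s $ 1" and "v = x s $ 2"
    have "u0 - u < 1/2" "- 2 - v < 1/2" "v + 1 + D * exp (- (\<delta> * u)) < 1/2"
      using max[of 0] max[of 1] max[of 2] *(2) by (auto simp: f_def u_def v_def)
    moreover have "0 < D * exp (- (\<delta> * u))" using pos by simp
    ultimately have uv: "0 < u" "- 3 \<le> v" "v \<le> - 1 / 2" using u0 by linarith+
    have Fu: "0 < ?F (x s) $ 1" unfolding exp_field_sign using q uv by (simp add: v_def mult_neg_neg)
    have "0 < (a3 - a4) * u" "0 < (b3 - b4) * v"
      using r s uv by (auto intro: mult_pos_pos mult_neg_neg)
    then have Fv: "0 < ?F (x s) $ 2" unfolding exp_field_sign u_def v_def by linarith
    have "?F (x s) $ 2 < exp (a3 * u) * exp (b3 * v)"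
      by (simp add: exp_field_nth u_def v_def exp_add)
    also have "\<dots> \<le> exp (a3 * u) * exp (3 * \<bar>b3\<bar>)" using strip(2)[OF uv(2,3)] by (intro mult_left_mono) auto
    also have "\<dots> = D * \<delta> * exp (- (\<delta> * u)) * (exp (a * u) * \<mu>)"
    proof -
      have "exp (- (\<delta> * u)) * exp (a * u) = exp (a3 * u)"
        by (simp add: \<delta>_def exp_add[symmetric] algebra_simps)
      moreover have "D * \<delta> * \<mu> = exp (3 * \<bar>b3\<bar>)" using pos by (simp add: D_def)
      ultimately show ?thesis by (metis (no_types, lifting) mult.assoc mult.commute)
    qed
    also have "\<dots> \<le> D * \<delta> * exp (- (\<delta> * u)) * ?F (x s) $ 1"
    proof (rule mult_left_mono)
      have "exp (a * u) * \<mu> \<le> exp (a * u) * (exp (b1 * v) - exp (b2 * v))"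
        using strip(1)[OF uv(2,3)] by (intro mult_left_mono) auto
      then show "exp (a * u) * \<mu> \<le> ?F (x s) $ 1"
        by (simp add: exp_field_nth u_def v_def exp_add right_diff_distrib)
    qed (use pos in auto)
    finally have "?F (x s) $ 2 < D * \<delta> * exp (- (\<delta> * u)) * ?F (x s) $ 1" .
    then show "f' i s < 0" using i Fu Fv by (auto simp: f'_def u_def)
  next
    fix i assume "i \<in> {0, 1, 2::nat}"
    then show "f i 0 \<le> 0" using D_u0 by (auto simp: f_def x0)
  qed (use t in auto)
  then have "u0 \<le> x t $ 1" if "0 \<le> t" for t using that by (simp add: f_def)
  then have "u0 \<le> C" using C[OF x(1)] by blast
  then show False using u0 by simp
qed

lemma not_permanent_lyap_nondecreasing_signed:
  assumes qr: "(b1 - b2) * (a3 - a4) < 0" and ps: "a2 \<le> a1" "b4 \<le> b3"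
  shows "\<not> permanent (exp_field a1 a2 a3 a4 b1 b2 b3 b4)"
proof (cases "b1 < b2")
  case True
  then have "a4 < a3" using qr by (auto simp: mult_less_0_iff)
  then show ?thesis using True ps by (intro not_permanent_lyap_nondecreasing)
next
  case False
  then have "b2 < b1" "a3 < a4" using qr by (auto simp: mult_less_0_iff)
  then have "\<not> permanent (exp_field (- a2) (- a1) (- a3) (- a4) b2 b1 b3 b4)"
    using ps by (intro not_permanent_lyap_nondecreasing) auto
  then show ?thesis using exp_field_permanent_flips(1) by blast
qed

text \<open>After a reflection \<open>q, r \<ge> 0\<close>, and it remains to find a direction \<open>(m, n)\<close> in the open first
quadrant whose image under \<open>J\<close> lies there too: \<open>(1, 1)\<close> if \<open>p, s \<ge> 0\<close>, and \<open>(q - s, r - p)\<close> if \<open>p, s \<le> 0\<close>,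
which \<open>J\<close> maps to \<open>(q r - p s) (1, 1)\<close>.\<close>

lemma not_permanent_saddle_or_node:
  assumes ps: "0 \<le> (a1 - a2) * (b3 - b4)"
    and J: "(a1 - a2) * (b3 - b4) < (b1 - b2) * (a3 - a4) \<or>
            a2 < a1 \<and> b4 < b3 \<and> 0 \<le> (b1 - b2) * (a3 - a4)"
  shows "\<not> permanent (exp_field a1 a2 a3 a4 b1 b2 b3 b4)"
proof -
  have *: "\<not> permanent (exp_field a1 a2 a3 a4 b1 b2 b3 b4)"
    if q: "b2 \<le> b1" and r: "a4 \<le> a3" and ps: "0 \<le> (a1 - a2) * (b3 - b4)"
      and J: "(a1 - a2) * (b3 - b4) < (b1 - b2) * (a3 - a4) \<or> a2 < a1 \<and> b4 < b3"
    for a1 a2 a3 a4 b1 b2 b3 b4 :: real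
  proof (cases "a2 \<le> a1 \<and> b4 \<le> b3")
    case True
    have "b2 < b1 \<and> a4 < a3" if "(a1 - a2) * (b3 - b4) < (b1 - b2) * (a3 - a4)"
    proof -
      have "0 < (b1 - b2) * (a3 - a4)" using ps that by linarith
      then show ?thesis using q r by (auto simp: zero_less_mult_iff)
    qed
    then show ?thesis
      using True J q r by (intro not_permanent_expanding_quadrant[of _ _ _ _ 1 1]) auto
  next
    case False
    then have neg: "a1 \<le> a2" "b3 \<le> b4" "a1 < a2 \<or> b3 < b4"
      using ps by (auto simp: zero_le_mult_iff)
    then have det: "(a1 - a2) * (b3 - b4) < (b1 - b2) * (a3 - a4)" using J by linarith
    then have "0 < (b1 - b2) * (a3 - a4)" using ps by linarith
    then have "b2 < b1" "a4 < a3" using q r by (auto simp: zero_less_mult_iff)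
    then show ?thesis
      using neg det
      by (intro not_permanent_expanding_quadrant[of _ _ _ _ "(b1 - b2) + (b4 - b3)" "(a3 - a4) + (a2 - a1)"])
        (auto simp: algebra_simps)
  qed
  have "0 \<le> (b1 - b2) * (a3 - a4)" using J ps by linarith
  then consider "b2 \<le> b1" "a4 \<le> a3" | "b1 \<le> b2" "a3 \<le> a4" by (auto simp: zero_le_mult_iff)
  then show ?thesis
  proof cases
    case 1
    then show ?thesis using ps J by (intro *) auto
  next
    case 2
    have "\<not> permanent (exp_field (- a2) (- a1) (- a3) (- a4) b2 b1 b3 b4)"
      using 2 ps J by (intro *) (auto simp: algebra_simps)
    then show ?thesis using exp_field_permanent_flips(1) by blast
  qed
qed

text \<open>Reflecting \<open>u\<close> exchanges the cases \<open>a < min a3 a4\<close> and \<open>a > max a3 a4\<close>; reflecting \<open>v\<close> changes the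
signs of \<open>q\<close> and \<open>r\<close> but leaves \<open>a\<close>, \<open>min a3 a4\<close> and \<open>max a3 a4\<close> alone.\<close>

lemma not_permanent_degenerate_diagonal:
  assumes qr: "(b1 - b2) * (a3 - a4) < 0" and s: "b3 < b4"
    and a: "\<not> (min a3 a4 \<le> a \<and> a \<le> max a3 a4)"
  shows "\<not> permanent (exp_field a a a3 a4 b1 b2 b3 b4)"
proof -
  have *: "\<not> permanent (exp_field a a a3 a4 b1 b2 b3 b4)"
    if qr: "(b1 - b2) * (a3 - a4) < 0" and s: "b3 < b4" and a: "max a3 a4 < a"
    for a a3 a4 b1 b2 b3 b4 :: real
  proof (cases "b1 < b2")
    case True
    then have "a4 < a3" using qr by (auto simp: mult_less_0_iff)
    then show ?thesis using True s a by (intro not_permanent_escape_strip) auto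
  next
    case False
    then have "b2 < b1" "a3 < a4" using qr by (auto simp: mult_less_0_iff)
    then have "\<not> permanent (exp_field a a a4 a3 (- b1) (- b2) (- b4) (- b3))"
      using s a by (intro not_permanent_escape_strip) auto
    then show ?thesis using exp_field_permanent_flips(2) by blast
  qed
  show ?thesis
  proof (cases "max a3 a4 < a")
    case True
    then show ?thesis using qr s by (intro *)
  next
    case False
    have "\<not> permanent (exp_field (- a) (- a) (- a3) (- a4) b2 b1 b3 b4)"
      using False a qr s by (intro *) (auto simp: algebra_simps)
    then show ?thesis using exp_field_permanent_flips(1) by blast
  qed
qed

section \<open>The equivalence\<close>

theorem theorem3p2:
  fixes a1 a2 a3 a4 b1 b2 b3 b4 :: real
  defines "F \<equiv> exp_field a1 a2 a3 a4 b1 b2 b3 b4"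
    and "J \<equiv> jacobian_at_origin a1 a2 a3 a4 b1 b2 b3 b4"
  assumes "J $ 1 $ 1 * J $ 2 $ 2 \<ge> 0"
  shows "(permanent F \<longleftrightarrow> globally_asymptotically_stable F 0) \<and>
    (globally_asymptotically_stable F 0 \<longleftrightarrow>
      det J > 0 \<and>
      ((sgn (J $ 1 $ 1) = -1 \<and> sgn (J $ 2 $ 2) = -1) \<or>
       (sgn (J $ 1 $ 1) = 0 \<and> sgn (J $ 2 $ 2) = -1 \<and>
          min a3 a4 \<le> a2 \<and> a2 = a1 \<and> a1 \<le> max a3 a4) \<or>
       (sgn (J $ 1 $ 1) = -1 \<and> sgn (J $ 2 $ 2) = 0 \<and>
          min b1 b2 \<le> b4 \<and> b4 = b3 \<and> b3 \<le> max b1 b2)))"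
    (is "(?i \<longleftrightarrow> ?ii) \<and> (?ii \<longleftrightarrow> ?iii)")
proof -
  have J: "J $ 1 $ 1 = a1 - a2" "J $ 2 $ 2 = b3 - b4"
    "det J = (a1 - a2) * (b3 - b4) - (b1 - b2) * (a3 - a4)"
    by (simp_all add: J_def jacobian_at_origin_def det_2)
  have sgn_neg: "sgn x = -1 \<longleftrightarrow> x < 0" for x :: real by (simp add: sgn_if)
  have ps: "0 \<le> (a1 - a2) * (b3 - b4)" using assms(3) by (simp add: J)
  have iii: "?iii \<longleftrightarrow> (b1 - b2) * (a3 - a4) < (a1 - a2) * (b3 - b4) \<and>
      (a1 < a2 \<and> b3 < b4 \<or>
       a1 = a2 \<and> b3 < b4 \<and> min a3 a4 \<le> a1 \<and> a1 \<le> max a3 a4 \<or>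
       a1 < a2 \<and> b3 = b4 \<and> min b1 b2 \<le> b3 \<and> b3 \<le> max b1 b2)"
    unfolding J sgn_neg sgn_0_0 by auto
  have "?iii" if perm: "?i"
  proof -
    note perm' = perm[unfolded F_def]
    have det: "(b1 - b2) * (a3 - a4) < (a1 - a2) * (b3 - b4)"
      using not_permanent_singular not_permanent_saddle_or_node[OF ps] perm'
      by (metis linorder_neqE_linordered_idom)
    have not_nonneg: "\<not> (a2 \<le> a1 \<and> b4 \<le> b3)"
    proof
      assume nn: "a2 \<le> a1 \<and> b4 \<le> b3"
      then have "0 \<le> (b1 - b2) * (a3 - a4)"
        using not_permanent_lyap_nondecreasing_signed perm' by (meson not_le)
      moreover from this have "a2 < a1" "b4 < b3" using det nn by (auto simp: less_le)
      ultimately show False using not_permanent_saddle_or_node[OF ps] perm' by blast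
    qed
    then have "a1 \<le> a2" "b3 \<le> b4" using ps by (auto simp: zero_le_mult_iff)
    then consider "a1 < a2" "b3 < b4" | "a1 = a2" "b3 < b4" | "a1 < a2" "b3 = b4"
      using not_nonneg by (cases "a1 = a2"; cases "b3 = b4"; auto)
    then show ?thesis
    proof cases
      case 1
      then show ?thesis using det unfolding iii by blast
    next
      case 2
      then have "(b1 - b2) * (a3 - a4) < 0" using det by simp
      then have "min a3 a4 \<le> a1 \<and> a1 \<le> max a3 a4"
        using not_permanent_degenerate_diagonal[of b1 b2 a3 a4 b3 b4 a1] 2 perm' by blast
      then show ?thesis using 2 det unfolding iii by blast
    next
      case 3
      then have "(a3 - a4) * (b1 - b2) < 0" using det by (simp add: mult.commute)
      then have "min b1 b2 \<le> b3 \<and> b3 \<le> max b1 b2"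
        using not_permanent_degenerate_diagonal[of a3 a4 b1 b2 a1 a2 b3] 3
          exp_field_permanent_flips(3)[OF perm'] by blast
      then show ?thesis using 3 det unfolding iii by blast
    qed
  qed
  moreover have "?ii" if "?iii"
  proof -
    have det: "(b1 - b2) * (a3 - a4) < (a1 - a2) * (b3 - b4)"
      and cases: "a1 < a2 \<and> b3 < b4 \<or>
       a1 = a2 \<and> b3 < b4 \<and> min a3 a4 \<le> a1 \<and> a1 \<le> max a3 a4 \<or>
       a1 < a2 \<and> b3 = b4 \<and> min b1 b2 \<le> b3 \<and> b3 \<le> max b1 b2"
      using that unfolding iii by auto
    consider "a1 < a2" "b3 < b4" "\<bar>(b1 - b2) * (a3 - a4)\<bar> < (a1 - a2) * (b3 - b4)"
      | "(b1 - b2) * (a3 - a4) < 0" "b3 < b4" "a1 \<le> a2" "a1 = a2 \<longrightarrow> min a3 a4 \<le> a1 \<and> a1 \<le> max a3 a4"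
      | "(b1 - b2) * (a3 - a4) < 0" "b3 = b4" "a1 < a2" "min b1 b2 \<le> b3 \<and> b3 \<le> max b1 b2"
      using cases det by (cases "(b1 - b2) * (a3 - a4) < 0") auto
    then show ?ii
    proof cases
      case 1
      then show ?thesis
        unfolding F_def by (rule globally_asymptotically_stable_diagonal_dominant)
    next
      case 2
      then show ?thesis
        unfolding F_def by (intro globally_asymptotically_stable_opposite_signs) auto
    next
      case 3
      then have "globally_asymptotically_stable (exp_field b3 b4 b1 b2 a3 a4 a1 a2) 0"
        by (intro globally_asymptotically_stable_opposite_signs) (auto simp: mult.commute)
      from exp_field_stable_flips(2)[OF this] show ?thesis unfolding F_def .
    qed
  qed
  moreover have "?i" if "?ii" using that by (rule permanent_if_globally_asymptotically_stable)
  ultimately show ?thesis by blast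
qed

end
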